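(* Consider a radiation source moving in $\mathbb{R}^2$ on the linear trajectory $$x(t)=x_o^*+s^*(t-t_o)\sin\theta^*,\qquad y(t)=y_o^*+s^*(t-t_o)\cos\theta^*,$$ with unknown parameters $x_o^*,y_o^*\in\mathbb{R}$, $\theta^*\in[0,2\pi)$, constant speed $s^*>0$, and known reference time $t_o$. Suppose the source triggers $n=3$ binary proximity sensors located at points $(x_j,y_j)$, $j\in\{1,2,3\}$, whose locations are independent and identically distributed in $\mathbb{R}^2$ (with a distribution absolutely continuous with respect to Lebesgue measure), and suppose the noise-free time stamps $t_{j1}^*,t_{j2}^*$, $j\in\{1,2,3\}$ (defined in the context) are available, while the source intensity $\lambda_s^*$ is unknown. Then, with probability one, the linear trajectory (i.e. the parameters $\theta^*,s^*,x_o^*,y_o^*$) is uniquely determined by the three sensor locations $(x_j,y_j)$ and the time stamps $\{t_{j1}^*,t_{j2}^*\}$, $j\in\{1,2,3\}$.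
   Context: Sensors and the source are modeled as points. The distance from sensor $j$ to the source at time $t$ is $d_j(t)=\sqrt{(x(t)-x_j)^2+(y(t)-y_j)^2}$. The noise-free expected received photon rate at sensor $j$ is $z_j(t)=\lambda_s^*e^{-\alpha_s d_j(t)}/d_j(t)^2+\lambda_b$, where $\lambda_s^*>0$ (photon count per second at unit distance with no shielding) is unknown, $\alpha_s\ge 0$ is a shielding coefficient, $\lambda_b$ is the background rate, and $\lambda_T>\lambda_b$ is a threshold fixed a priori. The time stamps recorded by sensor $j$ are $t_{j1}^*$, the smallest $t$, and $t_{j2}^*$, the largest $t$, such that $\int_{t-1/2}^{t+1/2}\frac{e^{-\alpha_s d_j(\tau)}}{d_j(\tau)^2}\,d\tau\ \ge\ \frac{\lambda_T-\lambda_b}{\lambda_s^*}$ (entry into and exit from the sensing range). Standing assumptions: the sensor locations are distinct, i.i.d., with zero mean in each coordinate; the source moves with constant speed; and the noise-free received photon count at each sensor is unimodal in time. *)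

theory Defs
  imports "HOL-Probability.Probability"
begin

definition traj_x :: "real \<Rightarrow> real \<Rightarrow> real \<Rightarrow> real \<Rightarrow> real \<Rightarrow> real" where
  "traj_x t0 xo theta s t = xo + s * (t - t0) * sin theta"

definition traj_y :: "real \<Rightarrow> real \<Rightarrow> real \<Rightarrow> real \<Rightarrow> real \<Rightarrow> real" where
  "traj_y t0 yo theta s t = yo + s * (t - t0) * cos theta"

definition src_dist :: "real \<Rightarrow> real \<Rightarrow> real \<Rightarrow> real \<Rightarrow> real \<Rightarrow> real \<times> real \<Rightarrow> real \<Rightarrow> real" where
  "src_dist t0 xo yo theta s p t =
     sqrt ((traj_x t0 xo theta s t - fst p)^2 + (traj_y t0 yo theta s t - snd p)^2)"

definition window_int :: "real \<Rightarrow> real \<Rightarrow> real \<Rightarrow> real \<Rightarrow> real \<Rightarrow> real \<Rightarrow> real \<times> real \<Rightarrow> real \<Rightarrow> real" where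
  "window_int alpha t0 xo yo theta s p t =
     integral {t - 1/2 .. t + 1/2}
       (\<lambda>tau. exp (- alpha * src_dist t0 xo yo theta s p tau) / (src_dist t0 xo yo theta s p tau)^2)"

definition trig_set :: "real \<Rightarrow> real \<Rightarrow> real \<Rightarrow> real \<Rightarrow> real \<Rightarrow> real \<Rightarrow> real \<Rightarrow> real \<Rightarrow> real \<Rightarrow> real \<times> real \<Rightarrow> real set" where
  "trig_set alpha lam_b lam_T t0 xo yo theta s lam_s p =
     {t. window_int alpha t0 xo yo theta s p t \<ge> (lam_T - lam_b) / lam_s}"

definition time_stamps :: "real \<Rightarrow> real \<Rightarrow> real \<Rightarrow> real \<Rightarrow> real \<Rightarrow> real \<Rightarrow> real \<Rightarrow> real \<Rightarrow> real \<Rightarrow> real \<times> real \<Rightarrow> real \<Rightarrow> real \<Rightarrow> bool" where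
  "time_stamps alpha lam_b lam_T t0 xo yo theta s lam_s p t1 t2 \<longleftrightarrow>
     (t1 \<in> trig_set alpha lam_b lam_T t0 xo yo theta s lam_s p \<and>
      (\<forall>t \<in> trig_set alpha lam_b lam_T t0 xo yo theta s lam_s p. t1 \<le> t)) \<and>
     (t2 \<in> trig_set alpha lam_b lam_T t0 xo yo theta s lam_s p \<and>
      (\<forall>t \<in> trig_set alpha lam_b lam_T t0 xo yo theta s lam_s p. t \<le> t2))"

end

(*
  In coordinates adapted to the trajectory, a sensor at signed offset h from the line and with
  time t_p of closest approach records stamps that are symmetric about t_p: t_p is their midpoint.
  The three midpoints of non-collinear sensors determine the direction and the speed, so that a
  competing trajectory is parallel to the true one, and the only freedom left is a shift d of the
  offsets, together with the unknown intensity.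

  With k = h / s and a = alpha s, let F k u be the rate integral over a unit window whose centre is
  at temporal distance u from the closest approach.  The half-widths u_i satisfy F k_i u_i = c for
  the true trajectory and F (k_i + d) u_i = c' for the competitor.  For fixed k_1 <> k_2 only
  countably many d satisfy F (k_1 + d) u_1 = F (k_2 + d) u_2; each of them determines c', and for
  fixed d <> 0 and c' only countably many k_3 are compatible.  Both countability claims are
  instances of the identity theorem: a level set of a real-analytic function on an interval is
  countable or everything.  "Everything" is impossible in the first case because F (., u) has its
  unique maximum at 0, and in the second because F and the half-width function are even.
  Analyticity of the half-width k -> u, defined by F k u = c, comes from a Newton iteration in the
  complex domain.  Hence the exceptional triples are null by Fubini; they form a Borel set as a
  projection of a sigma-compact set.
*)

theory Submission
  imports Defs "HOL-Complex_Analysis.Complex_Analysis"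
begin

section \<open>The windowed rate\<close>

text \<open>The argument is the squared distance, which is polynomial in offset and time; only the
  square root needs care when passing to complex arguments.\<close>

definition decay :: "real \<Rightarrow> real \<Rightarrow> real" where
  "decay a r = exp (- a * sqrt r) / r"

text \<open>Moving the window to the fixed interval \<open>{0..1}\<close> puts both parameters into
  the integrand, where the theorems on parameter-dependent integrals apply.\<close>

definition window :: "real \<Rightarrow> real \<Rightarrow> real \<Rightarrow> real" where
  "window a k u = integral {0..1} (\<lambda>t. decay a (k\<^sup>2 + (u - 1/2 + t)\<^sup>2))"

text \<open>The integrand of \<open>window\<close> is singular on the window exactly when \<open>regular\<close> fails; it is then
  not integrable, and \<open>integral\<close> returns \<open>0\<close>.\<close>

definition regular :: "real \<Rightarrow> real \<Rightarrow> bool" where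
  "regular k u \<longleftrightarrow> k \<noteq> 0 \<or> \<bar>u\<bar> > 1/2"

lemma decay_strict_antimono:
  assumes "a \<ge> 0" "0 < r" "r < r'"
  shows "decay a r' < decay a r"
proof -
  have "exp (- a * sqrt r') \<le> exp (- a * sqrt r)"
    using assms by (simp add: mult_left_mono)
  then show ?thesis
    unfolding decay_def using assms
    by (intro frac_less2) auto
qed

lemma regular_dist_pos:
  assumes "regular k u" "t \<in> {0..1}"
  shows "k\<^sup>2 + (u - 1/2 + t)\<^sup>2 > 0"
proof (cases "k = 0")
  case True
  then have "u - 1/2 + t \<noteq> 0"
    using assms by (auto simp: regular_def)
  then show ?thesis by (simp add: True)
next
  case False
  then show ?thesis by (simp add: add_pos_nonneg)
qed

lemma continuous_on_decay_comp [continuous_intros]: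
  assumes "continuous_on S g" "\<And>x. x \<in> S \<Longrightarrow> g x > 0"
  shows "continuous_on S (\<lambda>x. decay a (g x))"
  unfolding decay_def using assms by (intro continuous_intros) (auto simp: less_imp_neq[symmetric] dest: less_imp_neq)

lemma continuous_on_window_integrand:
  assumes "regular k u"
  shows "continuous_on {0..1} (\<lambda>t. decay a (k\<^sup>2 + (u - 1/2 + t)\<^sup>2))"
  using regular_dist_pos[OF assms] by (intro continuous_intros) auto

section \<open>Symmetry and strict monotonicity of the windowed rate\<close>

lemma window_minus_left: "window a (- k) u = window a k u"
  by (simp add: window_def)

lemma window_minus_right: "window a k (- u) = window a k u"
proof -
  let ?f = "\<lambda>t. decay a (k\<^sup>2 + (u - 1/2 + t)\<^sup>2)"
  have "integral {0..1} (\<lambda>t. ?f (1 - t)) = integral {0..1} ?f"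
  proof -
    have "integral {0..1} ?f = integral {-1..0} (\<lambda>t. ?f (- t))"
      using Henstock_Kurzweil_Integration.integral_reflect_real[of 1 0 ?f] by simp
    also have "\<dots> = integral {-1 - -1..0 - -1} (\<lambda>t. ?f (- (t + -1)))"
      by (subst integral_shift_real_ivl) simp
    finally show ?thesis by (simp add: algebra_simps)
  qed
  moreover have "(u - 1/2 + (1 - t))\<^sup>2 = (- u - 1/2 + t)\<^sup>2" for t
    by (simp add: power2_eq_square algebra_simps)
  ultimately show ?thesis
    by (simp add: window_def)
qed

lemma window_abs: "window a \<bar>k\<bar> \<bar>u\<bar> = window a k u"
  by (simp add: abs_if window_minus_left window_minus_right)

lemma window_strict_antimono_left:
  assumes "a \<ge> 0" "regular k u" "\<bar>k\<bar> < \<bar>k'\<bar>"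
  shows "window a k' u < window a k u"
  unfolding window_def
proof (rule integral_less_real)
  have "regular k' u" using assms by (auto simp: regular_def)
  then show "continuous_on {0..1} (\<lambda>t. decay a (k'\<^sup>2 + (u - 1/2 + t)\<^sup>2))"
    by (rule continuous_on_window_integrand)
  show "continuous_on {0..1} (\<lambda>t. decay a (k\<^sup>2 + (u - 1/2 + t)\<^sup>2))"
    using assms(2) by (rule continuous_on_window_integrand)
  fix t :: real assume t: "t \<in> {0<..<1}"
  have "k\<^sup>2 < k'\<^sup>2" using assms(3) by (simp add: power2_strict_mono)
  then show "decay a (k'\<^sup>2 + (u - 1/2 + t)\<^sup>2) < decay a (k\<^sup>2 + (u - 1/2 + t)\<^sup>2)"
    using assms t by (intro decay_strict_antimono regular_dist_pos) auto
qed auto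

lemma window_shift: "window a k u = integral {u - 1/2..u + 1/2} (\<lambda>t. decay a (k\<^sup>2 + t\<^sup>2))"
  using integral_shift_real_ivl[of "u - 1/2" "u - 1/2" "u + 1/2" "\<lambda>t. decay a (k\<^sup>2 + t\<^sup>2)"]
  by (simp add: window_def algebra_simps)

text \<open>Sliding the window from \<open>u\<close> to \<open>u'\<close> drops a left piece and
  gains its translate by one. Since \<open>u\<close> is nonnegative, each point of the left piece is
  closer to the closest approach than its translate, so the loss exceeds the gain.\<close>

lemma window_strict_antimono_right:
  assumes "a \<ge> 0" "regular k u" "0 \<le> u" "u < u'"
  shows "window a k u' < window a k u"
proof -
  define e where "e = (\<lambda>t. decay a (k\<^sup>2 + t\<^sup>2))"
  have pos: "k\<^sup>2 + t\<^sup>2 > 0" if "t \<ge> u - 1/2" for t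
  proof (cases "k = 0")
    case True
    then show ?thesis using assms that by (auto simp: regular_def)
  next
    case False
    then show ?thesis by (simp add: add_pos_nonneg)
  qed
  have cont: "continuous_on S e" if "S \<subseteq> {u - 1/2..}" for S
    unfolding e_def using pos that by (intro continuous_intros) auto
  have int: "e integrable_on {u - 1/2..u' + 1/2}"
    by (intro integrable_continuous_real cont) auto
  \<comment> \<open>Splitting the hull of both windows in two ways also covers the case of disjoint
    windows.\<close>
  have 1: "integral {u - 1/2..u + 1/2} e + integral {u + 1/2..u' + 1/2} e = integral {u - 1/2..u' + 1/2} e"
    using assms by (intro Henstock_Kurzweil_Integration.integral_combine int) auto
  have 2: "integral {u - 1/2..u' - 1/2} e + integral {u' - 1/2..u' + 1/2} e = integral {u - 1/2..u' + 1/2} e"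
    using assms by (intro Henstock_Kurzweil_Integration.integral_combine int) auto
  have 3: "integral {u + 1/2..u' + 1/2} e = integral {u - 1/2..u' - 1/2} (\<lambda>t. e (t + 1))"
    using integral_shift_real_ivl[of "u + 1/2" 1 "u' + 1/2" e] by simp
  have "integral {u - 1/2..u' - 1/2} (\<lambda>t. e (t + 1)) < integral {u - 1/2..u' - 1/2} e"
  proof (rule integral_less_real)
    show "continuous_on {u - 1/2..u' - 1/2} (\<lambda>t. e (t + 1))"
      by (rule continuous_on_compose2[OF cont[OF order_refl]]) (auto intro!: continuous_intros)
    show "continuous_on {u - 1/2..u' - 1/2} e" by (rule cont) auto
    fix t assume t: "t \<in> {u - 1/2<..<u' - 1/2}"
    then have "k\<^sup>2 + t\<^sup>2 < k\<^sup>2 + (t + 1)\<^sup>2"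
      using assms by (simp add: power2_eq_square algebra_simps)
    then show "e (t + 1) < e t"
      unfolding e_def using assms t by (intro decay_strict_antimono pos) auto
  qed (use assms in auto)
  then show ?thesis
    using 1 2 3 by (simp add: window_shift flip: e_def)
qed

lemma continuous_on_window:
  "continuous_on {(k, u). regular k u} (\<lambda>(k, u). window a k u)"
proof -
  have "continuous_on {(k, u). regular k u} (\<lambda>x. integral (cbox 0 1)
          (\<lambda>t. decay a ((fst x)\<^sup>2 + (snd x - 1/2 + t)\<^sup>2)))"
    by (rule integral_continuous_on_param)
      (auto simp: case_prod_unfold intro!: continuous_intros regular_dist_pos)
  then show ?thesis
    by (simp add: window_def case_prod_unfold)
qed

lemma open_regular: "open {(k, u). regular k u}"
proof -
  have "open ({x::real\<times>real. fst x \<noteq> 0} \<union> {x. \<bar>snd x\<bar> > 1/2})"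
    by (intro open_Un open_Collect_neq open_Collect_less continuous_intros)
  also have "{x::real\<times>real. fst x \<noteq> 0} \<union> {x. \<bar>snd x\<bar> > 1/2} = {(k, u). regular k u}"
    by (auto simp: regular_def)
  finally show ?thesis .
qed

text \<open>By monotonicity in both absolute values, the corner \<open>(d, 1/2 + d)\<close> of the
  box minimises the rate over its regular points. There the first \<open>d\<close> units of the
  window alone contribute \<open>B / d\<close>, which is unbounded as \<open>d\<close>
  shrinks.\<close>

lemma window_large_near_singularity:
  assumes "a \<ge> 0"
  obtains \<delta> where "\<delta> > 0" "\<And>k u. \<bar>k\<bar> \<le> \<delta> \<Longrightarrow> \<bar>u\<bar> \<le> 1/2 + \<delta> \<Longrightarrow> regular k u \<Longrightarrow> window a k u > M"
proof -
  \<comment> \<open>On the piece \<open>{0..d}\<close> the squared distance is at most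
    \<open>5 * d\<^sup>2\<close>, so with \<open>d \<le> 1\<close> the distance is below
    \<open>3\<close>. The other bound on \<open>d\<close> makes \<open>B / d\<close> exceed
    \<open>M\<close>.\<close>
  define B where "B = exp (- a * 3) / 5"
  define d where "d = min 1 (B / (\<bar>M\<bar> + 1))"
  have B: "B > 0" by (simp add: B_def)
  have d: "0 < d" "d \<le> 1" "d \<le> B / (\<bar>M\<bar> + 1)" using B by (auto simp: d_def)
  have "M < B / d"
  proof -
    have "d * (\<bar>M\<bar> + 1) \<le> B" using d(3) by (simp add: pos_le_divide_eq)
    then have "d * M < B" using d(1)
      by (smt (verit) mult_less_cancel_left_pos)
    then show ?thesis using d(1) by (simp add: pos_less_divide_eq mult.commute)
  qed
  also have "B / d \<le> window a d (1/2 + d)"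
  proof -
    have reg: "regular d (1/2 + d)" using d by (simp add: regular_def)
    have io: "(\<lambda>t. decay a (d\<^sup>2 + (1/2 + d - 1/2 + t)\<^sup>2)) integrable_on {0..1}"
      by (rule integrable_continuous_real[OF continuous_on_window_integrand[OF reg]])
    have "integral {0..d} (\<lambda>t. B / d\<^sup>2) \<le> integral {0..d} (\<lambda>t. decay a (d\<^sup>2 + (1/2 + d - 1/2 + t)\<^sup>2))"
    proof (rule integral_le)
      show "(\<lambda>t. decay a (d\<^sup>2 + (1/2 + d - 1/2 + t)\<^sup>2)) integrable_on {0..d}"
        by (rule integrable_on_subinterval[OF io]) (use d in auto)
      fix t assume t: "t \<in> {0..d}"
      let ?r = "d\<^sup>2 + (1/2 + d - 1/2 + t)\<^sup>2"
      have "(d + t)\<^sup>2 \<le> (2 * d)\<^sup>2" using t d by (intro power_mono) auto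
      then have r5: "?r \<le> 5 * d\<^sup>2" by (simp add: power_mult_distrib)
      have d2: "d\<^sup>2 \<le> 1" using d by (simp add: power_le_one)
      have rp: "?r > 0" using d by (simp add: add_pos_nonneg)
      have "sqrt ?r \<le> sqrt 9" using r5 d2 by (intro real_sqrt_le_mono) linarith
      then have "sqrt ?r \<le> 3" by simp
      then have "exp (- a * 3) \<le> exp (- a * sqrt ?r)" using assms by (simp add: mult_left_mono)
      then have "exp (- a * 3) / (5 * d\<^sup>2) \<le> exp (- a * sqrt ?r) / ?r"
        using r5 rp by (intro frac_le) auto
      then show "B / d\<^sup>2 \<le> decay a ?r" by (simp add: decay_def B_def)
    qed auto
    also have "\<dots> \<le> integral {0..1} (\<lambda>t. decay a (d\<^sup>2 + (1/2 + d - 1/2 + t)\<^sup>2))"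
    proof (rule integral_subset_le)
      show "(\<lambda>t. decay a (d\<^sup>2 + (1/2 + d - 1/2 + t)\<^sup>2)) integrable_on {0..d}"
        by (rule integrable_on_subinterval[OF io]) (use d in auto)
      show "\<forall>x\<in>{0..1}. 0 \<le> decay a (d\<^sup>2 + (1/2 + d - 1/2 + x)\<^sup>2)"
        by (auto simp: decay_def)
    qed (use d io in auto)
    finally show ?thesis using d by (simp add: window_def power2_eq_square)
  qed
  finally have M: "M < window a d (1/2 + d)" .
  have "window a k u > M" if k: "\<bar>k\<bar> \<le> d" and u: "\<bar>u\<bar> \<le> 1/2 + d" and r: "regular k u" for k u
  proof -
    have "window a k u \<ge> window a d \<bar>u\<bar>"
    proof (cases "\<bar>k\<bar> = d")
      case True
      then show ?thesis using window_abs[of a k u] by simp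
    next
      case False
      then show ?thesis
        using window_strict_antimono_left[OF assms, of k "\<bar>u\<bar>" d] r k d window_abs[of a k u]
          window_abs[of a k "\<bar>u\<bar>"]
        by (auto simp: regular_def)
    qed
    moreover have "window a d \<bar>u\<bar> \<ge> window a d (1/2 + d)"
    proof (cases "\<bar>u\<bar> = 1/2 + d")
      case False
      then show ?thesis
        using window_strict_antimono_right[OF assms, of d "\<bar>u\<bar>" "1/2+d"] u d
        by (auto simp: regular_def)
    qed auto
    ultimately show ?thesis using M by linarith
  qed
  then show ?thesis using d(1) that by blast
qed

lemma window_small_beyond:
  assumes "a \<ge> 0" "c > 0"
  obtains u where "u > U" "window a k u < c"
proof -
  \<comment> \<open>The summands put \<open>u - 1/2\<close> above both \<open>1\<close> and
    \<open>1 / c\<close>, so the bound \<open>1 / (u - 1/2)\<^sup>2\<close> on the integrand falls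
    below \<open>c\<close>, whatever \<open>k\<close> is.\<close>
  define u where "u = max U 0 + 1/2 + 1 + 1 / c"
  have "1 / c > 0" using assms by simp
  moreover have "max U 0 \<ge> U" "max U 0 \<ge> 0" by auto
  ultimately have u: "u > U" "u - 1/2 > 0" unfolding u_def by linarith+
  have reg: "regular k u" using u by (auto simp: regular_def)
  have w: "u - 1/2 > 1/c" "u - 1/2 > 1"
    using \<open>1 / c > 0\<close> \<open>max U 0 \<ge> 0\<close> unfolding u_def by linarith+
  have "window a k u \<le> integral {0..1::real} (\<lambda>t. 1 / (u - 1/2)\<^sup>2)"
    unfolding window_def
  proof (rule integral_le)
    show "(\<lambda>t. decay a (k\<^sup>2 + (u - 1/2 + t)\<^sup>2)) integrable_on {0..1}"
      by (rule integrable_continuous_real[OF continuous_on_window_integrand[OF reg]])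
    fix t :: real assume t: "t \<in> {0..1}"
    have "(u - 1/2)\<^sup>2 \<le> (u - 1/2 + t)\<^sup>2" using u t by (intro power_mono) auto
    then have le: "(u - 1/2)\<^sup>2 \<le> k\<^sup>2 + (u - 1/2 + t)\<^sup>2" by (simp add: add_increasing)
    have "(u - 1/2)\<^sup>2 > 0" using u by simp
    then show "decay a (k\<^sup>2 + (u - 1/2 + t)\<^sup>2) \<le> 1 / (u - 1/2)\<^sup>2"
      unfolding decay_def using le assms by (intro frac_le) auto
  qed auto
  also have "\<dots> < c"
  proof -
    have "1 < c * (u - 1/2)" using w(1) assms by (simp add: pos_divide_less_eq mult.commute)
    also have "\<dots> < c * (u - 1/2)\<^sup>2"
      using w assms by (simp add: power2_eq_square)
    finally show ?thesis using u by (simp add: pos_divide_less_eq)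
  qed
  finally show ?thesis using that u by blast
qed

section \<open>Complex extension and the implicit function\<close>

definition cdecay :: "real \<Rightarrow> complex \<Rightarrow> complex" where
  "cdecay a z = exp (- of_real a * csqrt z) / z"

definition cwindow :: "real \<Rightarrow> complex \<Rightarrow> complex \<Rightarrow> complex" where
  "cwindow a k u = integral {0..1} (\<lambda>t::real. cdecay a (k\<^sup>2 + (u - 1/2 + of_real t)\<^sup>2))"

text \<open>In the right half-plane \<open>cdecay\<close> meets neither the pole nor the branch cut
  of the root; on real arguments the condition reduces to \<open>regular\<close>.\<close>

definition cregular :: "complex \<Rightarrow> complex \<Rightarrow> bool" where
  "cregular k u \<longleftrightarrow> (\<forall>t\<in>{0..1}. Re (k\<^sup>2 + (u - 1/2 + of_real t)\<^sup>2) > 0)"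

text \<open>The \<open>u\<close>-derivative, taken formally under the integral sign. Its continuity
  makes a Newton map with constant slope contract.\<close>

definition cwindow_deriv :: "real \<Rightarrow> complex \<Rightarrow> complex \<Rightarrow> complex" where
  "cwindow_deriv a k u = integral {0..1} (\<lambda>t::real.
     deriv (cdecay a) (k\<^sup>2 + (u - 1/2 + of_real t)\<^sup>2) * (2 * (u - 1/2 + of_real t)))"

lemma cdecay_of_real: "r > 0 \<Longrightarrow> cdecay a (of_real r) = of_real (decay a r)"
  by (simp add: cdecay_def decay_def flip: of_real_sqrt) (metis exp_of_real of_real_minus of_real_mult)

lemma cdecay_holomorphic: "cdecay a holomorphic_on {z. Re z > 0}"
  unfolding cdecay_def
  by (intro holomorphic_intros) (auto simp: complex_nonpos_Reals_iff)

lemma open_right_half_plane: "open {z. Re z > 0}"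
  by (intro open_Collect_less continuous_intros)

lemma cdecay_has_field_derivative:
  assumes "Re (f z) > 0" "(f has_field_derivative f') (at z within S)"
  shows "((\<lambda>z. cdecay a (f z)) has_field_derivative deriv (cdecay a) (f z) * f') (at z within S)"
  by (rule DERIV_chain2[OF holomorphic_derivI[OF cdecay_holomorphic open_right_half_plane] assms(2)])
    (use assms in auto)

lemma continuous_on_cdecay_comp [continuous_intros]:
  assumes "continuous_on S g" "\<And>x. x \<in> S \<Longrightarrow> Re (g x) > 0"
  shows "continuous_on S (\<lambda>x. cdecay a (g x))"
  by (rule continuous_on_compose2[OF holomorphic_on_imp_continuous_on[OF cdecay_holomorphic] assms(1)])
    (use assms in auto)

lemma continuous_on_deriv_cdecay_comp [continuous_intros]:
  assumes "continuous_on S g" "\<And>x. x \<in> S \<Longrightarrow> Re (g x) > 0"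
  shows "continuous_on S (\<lambda>x. deriv (cdecay a) (g x))"
  by (rule continuous_on_compose2[OF holomorphic_on_imp_continuous_on
        [OF holomorphic_deriv[OF cdecay_holomorphic open_right_half_plane]] assms(1)])
    (use assms in auto)

lemma cregularD: "cregular k u \<Longrightarrow> t \<in> {0..1} \<Longrightarrow> Re (k\<^sup>2 + (u - 1/2 + of_real t)\<^sup>2) > 0"
  by (simp add: cregular_def)

lemma of_real_dist_sq:
  "(of_real k)\<^sup>2 + (of_real u - 1/2 + of_real t :: complex)\<^sup>2 = of_real (k\<^sup>2 + (u - 1/2 + t)\<^sup>2)"
  by simp

lemma cregular_of_real: "cregular (of_real k) (of_real u) \<longleftrightarrow> regular k u"
proof
  assume "regular k u"
  then show "cregular (of_real k) (of_real u)"
    unfolding cregular_def of_real_dist_sq Re_complex_of_real by (auto intro: regular_dist_pos)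
next
  assume r: "cregular (of_real k) (of_real u)"
  show "regular k u"
  proof (rule ccontr)
    assume "\<not> regular k u"
    then have "k = 0" "1/2 - u \<in> {0..1}" by (auto simp: regular_def)
    then show False
      using r cregularD[OF r, of "1/2 - u", unfolded of_real_dist_sq Re_complex_of_real] by simp
  qed
qed

lemma cwindow_of_real:
  assumes "regular k u"
  shows "cwindow a (of_real k) (of_real u) = of_real (window a k u)"
proof -
  have "((\<lambda>t. of_real (decay a (k\<^sup>2 + (u - 1/2 + t)\<^sup>2)) :: complex)
          has_integral of_real (window a k u)) {0..1}"
    unfolding window_def
    by (intro has_integral_of_real integrable_integral integrable_continuous_real
        continuous_on_window_integrand assms)
  then have "((\<lambda>t. cdecay a (of_real (k\<^sup>2 + (u - 1/2 + t)\<^sup>2)))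
          has_integral of_real (window a k u)) {0..1}"
    by (rule has_integral_eq[rotated]) (use regular_dist_pos[OF assms] cdecay_of_real in force)
  then show ?thesis
    unfolding cwindow_def of_real_dist_sq by (rule integral_unique)
qed

text \<open>Since \<open>t\<close> ranges over a compact interval, the tube lemma yields one
  neighbourhood that works for all \<open>t\<close>.\<close>

lemma open_cregular: "open {(k, u). cregular k u}"
  unfolding open_subopen[of "{(k, u). cregular k u}"]
proof
  fix x assume x: "x \<in> {(k, u). cregular k u}"
  define W where "W = {y::(complex \<times> complex) \<times> real.
     Re ((fst (fst y))\<^sup>2 + (snd (fst y) - 1/2 + of_real (snd y))\<^sup>2) > 0}"
  have "open W"
    unfolding W_def by (intro open_Collect_less continuous_intros)
  moreover have "{x} \<times> {0..1} \<subseteq> W"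
    using x by (auto simp: W_def cregular_def)
  ultimately obtain X where X: "x \<in> X" "open X" "X \<times> {0..1} \<subseteq> W"
    using Elementary_Topology.tube_lemma[of "{0..1::real}" W x] by auto
  then have "X \<subseteq> {(k, u). cregular k u}"
    by (auto simp: W_def cregular_def)
  then show "\<exists>T. open T \<and> x \<in> T \<and> T \<subseteq> {(k, u). cregular k u}"
    using X by blast
qed

lemma continuous_on_cwindow:
  "continuous_on {(k, u). cregular k u} (\<lambda>(k, u). cwindow a k u)"
proof -
  have "continuous_on {(k, u). cregular k u} (\<lambda>x. integral (cbox 0 1)
          (\<lambda>t. cdecay a ((fst x)\<^sup>2 + (snd x - 1/2 + of_real t)\<^sup>2)))"
    by (rule integral_continuous_on_param)
      (auto simp: case_prod_unfold cregular_def intro!: continuous_intros)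
  then show ?thesis
    by (simp add: cwindow_def case_prod_unfold)
qed

lemma continuous_on_cwindow_deriv:
  "continuous_on {(k, u). cregular k u} (\<lambda>(k, u). cwindow_deriv a k u)"
proof -
  have "continuous_on {(k, u). cregular k u} (\<lambda>x. integral (cbox 0 1)
          (\<lambda>t. deriv (cdecay a) ((fst x)\<^sup>2 + (snd x - 1/2 + of_real t)\<^sup>2) *
            (2 * (snd x - 1/2 + of_real t))))"
    by (rule integral_continuous_on_param)
      (auto simp: case_prod_unfold cregular_def intro!: continuous_intros)
  then show ?thesis
    by (simp add: cwindow_deriv_def case_prod_unfold)
qed

section \<open>Differentiation of the complex rate under the integral sign\<close>

lemma cwindow_integrable:
  assumes "cregular k u"
  shows "(\<lambda>t::real. cdecay a (k\<^sup>2 + (u - 1/2 + of_real t)\<^sup>2)) integrable_on {0..1}"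
  using assms by (intro integrable_continuous_real continuous_intros) (auto simp: cregular_def)

lemma cwindow_has_field_derivative:
  assumes "convex U" "u \<in> U" "\<And>u. u \<in> U \<Longrightarrow> cregular k u"
  shows "(cwindow a k has_field_derivative cwindow_deriv a k u) (at u within U)"
proof -
  have "((\<lambda>u. integral (cbox 0 1) (\<lambda>t::real. cdecay a (k\<^sup>2 + (u - 1/2 + of_real t)\<^sup>2)))
     has_field_derivative integral (cbox 0 1) (\<lambda>t::real.
     deriv (cdecay a) (k\<^sup>2 + (u - 1/2 + of_real t)\<^sup>2) * (2 * (u - 1/2 + of_real t)))) (at u within U)"
  proof (rule leibniz_rule_field_derivative)
    fix u t assume ut: "u \<in> U" "t \<in> cbox 0 (1::real)"
    show "((\<lambda>u. cdecay a (k\<^sup>2 + (u - 1/2 + of_real t)\<^sup>2)) has_field_derivative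
       deriv (cdecay a) (k\<^sup>2 + (u - 1/2 + of_real t)\<^sup>2) * (2 * (u - 1/2 + of_real t))) (at u within U)"
      using ut assms(3) by (intro cdecay_has_field_derivative) (auto simp: cregular_def intro!: derivative_eq_intros)
  next
    show "continuous_on (U \<times> cbox 0 1) (\<lambda>(u, t). deriv (cdecay a) (k\<^sup>2 + (u - 1/2 + complex_of_real t)\<^sup>2) *
       (2 * (u - 1/2 + of_real t)))"
      using assms(3) by (auto simp: case_prod_unfold cregular_def intro!: continuous_intros)
  qed (use assms cwindow_integrable in auto)
  then show ?thesis
    by (simp add: cwindow_def[abs_def] cwindow_deriv_def)
qed

text \<open>Holomorphy along one-variable curves takes the place of joint holomorphy in
  \<open>(k, u)\<close>: it serves the Newton iterates and every later substitution of analytic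
  functions.\<close>

lemma cwindow_comp_holomorphic:
  assumes "open U" "convex U" "p holomorphic_on U" "q holomorphic_on U"
    and reg: "\<And>z. z \<in> U \<Longrightarrow> cregular (p z) (q z)"
  shows "(\<lambda>z. cwindow a (p z) (q z)) holomorphic_on U"
proof -
  have "(\<lambda>z. integral (cbox 0 1) (\<lambda>t::real. cdecay a ((p z)\<^sup>2 + (q z - 1/2 + of_real t)\<^sup>2))) holomorphic_on U"
  proof (rule leibniz_rule_holomorphic)
    fix z t assume zt: "z \<in> U" "t \<in> cbox 0 (1::real)"
    have p': "(p has_field_derivative deriv p z) (at z within U)"
      and q': "(q has_field_derivative deriv q z) (at z within U)"
      using assms zt by (auto intro!: holomorphic_derivI)
    show "((\<lambda>z. cdecay a ((p z)\<^sup>2 + (q z - 1/2 + of_real t)\<^sup>2)) has_field_derivative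
       deriv (cdecay a) ((p z)\<^sup>2 + (q z - 1/2 + of_real t)\<^sup>2) *
         (2 * p z * deriv p z + 2 * (q z - 1/2 + of_real t) * deriv q z)) (at z within U)"
      using zt reg by (intro cdecay_has_field_derivative)
        (auto simp: cregular_def intro!: derivative_eq_intros p' q')
  next
    have "continuous_on U p" "continuous_on U q" "continuous_on U (deriv p)" "continuous_on U (deriv q)"
      using assms by (auto intro!: holomorphic_on_imp_continuous_on holomorphic_deriv)
    note this[THEN continuous_on_compose2, continuous_intros]
    show "continuous_on (U \<times> cbox 0 1) (\<lambda>(z, t). deriv (cdecay a) ((p z)\<^sup>2 + (q z - 1/2 + complex_of_real t)\<^sup>2) *
         (2 * p z * deriv p z + 2 * (q z - 1/2 + of_real t) * deriv q z))"
      using reg by (auto simp: case_prod_unfold cregular_def intro!: continuous_intros)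
  qed (use assms cwindow_integrable in auto)
  then show ?thesis
    by (simp add: cwindow_def)
qed

text \<open>\<open>u\<close> and \<open>t\<close> enter only through \<open>u + t\<close>, so the
  integrand is a \<open>t\<close>-derivative and the integral a difference of end values. For
  \<open>u > 0\<close> the right end is farther from the closest approach, which makes the
  difference negative.\<close>

lemma cwindow_deriv_of_real:
  assumes "a \<ge> 0" "regular k u" "u > 0"
  obtains A where "A \<noteq> 0" "cwindow_deriv a (of_real k) (of_real u) = of_real A"
proof -
  let ?g = "\<lambda>t::real. (of_real k)\<^sup>2 + (of_real u - 1/2 + of_real t :: complex)\<^sup>2"
  have "((\<lambda>t::real. deriv (cdecay a) (?g t) * (2 * (of_real u - 1/2 + of_real t))) has_integral
     cdecay a (?g 1) - cdecay a (?g 0)) {0..1}"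
  proof (rule fundamental_theorem_of_calculus)
    fix t :: real assume t: "t \<in> {0..1}"
    have "((\<lambda>t. cdecay a ((of_real k)\<^sup>2 + (of_real u - 1/2 + t)\<^sup>2)) has_field_derivative
       deriv (cdecay a) (?g t) * (2 * (of_real u - 1/2 + of_real t))) (at (of_real t))"
      using assms t cregularD[of "of_real k" "of_real u" t]
      by (intro cdecay_has_field_derivative) (auto simp: cregular_of_real intro!: derivative_eq_intros)
    then show "((\<lambda>t. cdecay a (?g t)) has_vector_derivative
       deriv (cdecay a) (?g t) * (2 * (of_real u - 1/2 + of_real t))) (at t within {0..1})"
      by (rule has_vector_derivative_real_field)
  qed auto
  then have "cwindow_deriv a (of_real k) (of_real u) = cdecay a (?g 1) - cdecay a (?g 0)"
    unfolding cwindow_deriv_def by (rule integral_unique)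
  moreover have "cdecay a (?g t) = of_real (decay a (k\<^sup>2 + (u - 1/2 + t)\<^sup>2))" if "t \<in> {0..1}" for t
    unfolding of_real_dist_sq by (intro cdecay_of_real regular_dist_pos[OF assms(2) that])
  ultimately have "cwindow_deriv a (of_real k) (of_real u) =
     of_real (decay a (k\<^sup>2 + (u - 1/2 + 1)\<^sup>2) - decay a (k\<^sup>2 + (u - 1/2 + 0)\<^sup>2))"
    by (metis (no_types, lifting) atLeastAtMost_iff of_real_diff order_refl zero_le_one)
  moreover have "decay a (k\<^sup>2 + (u - 1/2 + 1)\<^sup>2) < decay a (k\<^sup>2 + (u - 1/2 + 0)\<^sup>2)"
  proof (rule decay_strict_antimono[OF assms(1) regular_dist_pos[OF assms(2)]])
    show "k\<^sup>2 + (u - 1/2 + 0)\<^sup>2 < k\<^sup>2 + (u - 1/2 + 1)\<^sup>2"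
      using assms(3) by (simp add: power2_eq_square algebra_simps)
  qed simp
  ultimately show ?thesis
    using that[of "decay a (k\<^sup>2 + (u - 1/2 + 1)\<^sup>2) - decay a (k\<^sup>2 + (u - 1/2 + 0)\<^sup>2)"]
    by (metis diff_0_right diff_eq_diff_eq less_irrefl)
qed

text \<open>Newton iterates started at the constant \<open>u0\<close> are holomorphic in
  \<open>k\<close> and converge uniformly, so their limit is holomorphic. For real \<open>k\<close>
  the iterates are real, hence so is the limit.\<close>

lemma analytic_implicit_function:
  assumes a: "a \<ge> 0" and reg: "regular k0 u0" and u0: "u0 > 0" and W: "window a k0 u0 = c"
  obtains r \<phi> where "r > 0" "\<phi> holomorphic_on ball (of_real k0) r"
    "\<And>k. \<bar>k - k0\<bar> < r \<Longrightarrow> \<exists>u>0. regular k u \<and> window a k u = c \<and> \<phi> (of_real k) = of_real u"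
proof -
  define A where "A = cwindow_deriv a (of_real k0) (of_real u0)"
  let ?k = "complex_of_real k0" and ?u = "complex_of_real u0"
  obtain A' where A': "A = of_real A'" and "A' \<noteq> 0"
    unfolding A_def using cwindow_deriv_of_real[OF a reg u0] by metis
  then have A: "A \<noteq> 0" by simp
  let ?R = "{(k, u). cregular k u}"
  have R0: "(?k, ?u) \<in> ?R" using reg by (simp add: cregular_of_real)
  have "isCont (\<lambda>(k, u). cwindow_deriv a k u) (?k, ?u)"
    using continuous_on_cwindow_deriv R0 open_cregular by (metis continuous_on_eq_continuous_at)
  \<comment> \<open>Slopes within \<open>norm A / 2\<close> of \<open>A\<close> give the contraction
    constant \<open>1/2\<close>.\<close>
  then obtain e1 where e1: "e1 > 0" "\<And>x. dist x (?k, ?u) < e1 \<Longrightarrow>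
      dist (case x of (k, u) \<Rightarrow> cwindow_deriv a k u) A < norm A / 2"
    unfolding continuous_at_eps_delta using A by (auto simp: A_def elim!: allE[of _ "norm A / 2"])
  obtain e2 where e2: "e2 > 0" "ball (?k, ?u) e2 \<subseteq> ?R"
    using open_cregular R0 by (rule openE)
  \<comment> \<open>Two distances of at most \<open>e\<close> add up to less than \<open>e1\<close>
    and \<open>e2\<close>; the bound \<open>u0 / 2\<close> keeps real fixed points positive.\<close>
  define e where "e = min (min e1 e2 / 3) (u0 / 2)"
  have e: "e > 0" "e \<le> e1 / 3" "e \<le> e2 / 3" "e \<le> u0 / 2"
    using e1(1) e2(1) u0 by (auto simp: e_def)
  have near: "dist (k, u) (?k, ?u) < e1 \<and> (k, u) \<in> ball (?k, ?u) e2"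
    if "dist k ?k < e" "u \<in> cball ?u e" for k u
  proof -
    have "dist (k, u) (?k, ?u) \<le> dist k ?k + dist u ?u"
      by (simp add: dist_prod_def sqrt_sum_squares_le_sum)
    also have "\<dots> \<le> 2 * e" using that by (simp add: dist_commute)
    finally show ?thesis using e by (auto simp: dist_commute)
  qed
  have reg_near: "cregular k u" if "dist k ?k < e" "u \<in> cball ?u e" for k u
    using near[OF that] e2 by auto
  have "isCont (\<lambda>(k, u). cwindow a k u) (?k, ?u)"
    using continuous_on_cwindow R0 open_cregular by (metis continuous_on_eq_continuous_at)
  \<comment> \<open>At the centre the Newton step then moves by at most \<open>e / 4\<close>; with
    the contraction, the disc of radius \<open>e\<close> is mapped into itself.\<close>
  then obtain e3 where e3: "e3 > 0" "\<And>x. dist x (?k, ?u) < e3 \<Longrightarrow>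
      dist (case x of (k, u) \<Rightarrow> cwindow a k u) (of_real c) < norm A * e / 4"
    unfolding continuous_at_eps_delta using A e(1) cwindow_of_real[OF reg, of a] W
    by (auto elim!: allE[of _ "norm A * e / 4"])
  define r where "r = min e e3"
  have r: "r > 0" "r \<le> e" "r \<le> e3" using e e3 by (auto simp: r_def)
  \<comment> \<open>Newton step with the frozen slope \<open>A\<close>: a contraction with constant \<open>1/2\<close>, uniformly in \<open>k\<close>.\<close>
  define T where "T = (\<lambda>k u. u - (cwindow a k u - of_real c) / A)"
  have lip: "dist (T k u) (T k u') \<le> 1/2 * dist u u'"
    if k: "dist k ?k < r" and "u \<in> cball ?u e" "u' \<in> cball ?u e" for k u u'
  proof -
    have "norm (T k u - T k u') \<le> 1/2 * norm (u - u')"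
    proof (rule field_differentiable_bound[where f' = "\<lambda>u. 1 - cwindow_deriv a k u / A" and S = "cball ?u e"])
      fix v assume v: "v \<in> cball ?u e"
      have "(cwindow a k has_field_derivative cwindow_deriv a k v) (at v within cball ?u e)"
        using v k r reg_near by (intro cwindow_has_field_derivative) auto
      then show "(T k has_field_derivative 1 - cwindow_deriv a k v / A) (at v within cball ?u e)"
        unfolding T_def using A by (auto intro!: derivative_eq_intros)
      have "dist (cwindow_deriv a k v) A < norm A / 2"
        using e1(2)[of "(k, v)"] near[of k v] v k r by auto
      moreover have "1 - cwindow_deriv a k v / A = (A - cwindow_deriv a k v) / A"
        using A by (simp add: field_simps)
      ultimately show "norm (1 - cwindow_deriv a k v / A) \<le> 1/2"
        using A by (simp add: norm_divide divide_simps dist_norm norm_minus_commute)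
    qed (use that in auto)
    then show ?thesis by (simp add: dist_norm)
  qed
  have T0: "dist (T k ?u) ?u \<le> e / 4" if k: "dist k ?k < r" for k
  proof -
    have "dist (cwindow a k ?u) (of_real c) < norm A * e / 4"
      using e3(2)[of "(k, ?u)"] k r by (simp add: dist_prod_def)
    moreover have "dist (T k ?u) ?u = dist (cwindow a k ?u) (of_real c) / norm A"
      by (simp add: T_def dist_norm norm_divide norm_minus_commute)
    ultimately have "norm A * dist (T k ?u) ?u < norm A * (e / 4)"
      using A by simp
    then have "dist (T k ?u) ?u < e / 4"
      using A by (subst (asm) mult_less_cancel_left_pos) auto
    then show ?thesis by simp
  qed
  have Tin: "T k u \<in> cball ?u e" if k: "dist k ?k < r" and u: "u \<in> cball ?u e" for k u
  proof -
    have "dist (T k u) ?u \<le> dist (T k u) (T k ?u) + dist (T k ?u) ?u" by (rule dist_triangle)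
    also have "\<dots> \<le> 1/2 * dist u ?u + e / 4"
      using lip[OF k u, of ?u] T0[OF k] e by auto
    also have "\<dots> \<le> e" using u e by (auto simp: dist_commute)
    finally show ?thesis by (simp add: dist_commute)
  qed
  have "\<exists>!u. u \<in> cball ?u e \<and> T k u = u" if k: "dist k ?k < r" for k
    using Banach_fix[of "cball ?u e" "1/2" "T k"] lip[OF k] Tin[OF k] e
    by (auto simp: image_subset_iff complete_eq_closed)
  then obtain \<phi> where \<phi>: "\<And>k. dist k ?k < r \<Longrightarrow> \<phi> k \<in> cball ?u e \<and> T k (\<phi> k) = \<phi> k" by metis
  define f where "f = (\<lambda>n k. (T k ^^ n) ?u)"
  have f_in: "f n k \<in> cball ?u e" if "dist k ?k < r" for n k
    by (induction n) (use that e Tin in \<open>auto simp: f_def\<close>)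
  have conv: "dist (f n k) (\<phi> k) \<le> (1/2)^n * e" if k: "dist k ?k < r" for n k
  proof (induction n)
    case 0
    then show ?case using \<phi>[OF k] by (simp add: f_def)
  next
    case (Suc n)
    have "dist (f (Suc n) k) (\<phi> k) = dist (T k (f n k)) (T k (\<phi> k))"
      using \<phi>[OF k] by (simp add: f_def)
    also have "\<dots> \<le> 1/2 * dist (f n k) (\<phi> k)"
      using k f_in[OF k] \<phi>[OF k] by (intro lip) auto
    also have "\<dots> \<le> (1/2)^Suc n * e" using Suc by simp
    finally show ?case .
  qed
  have small: "(\<lambda>n. (1/2)^n * e) \<longlonglongrightarrow> 0"
    by (intro tendsto_mult_left_zero LIMSEQ_power_zero) auto
  have ulim: "uniform_limit (ball ?k r) f \<phi> sequentially"
    unfolding uniform_limit_iff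
  proof (intro allI impI)
    fix d :: real assume "d > 0"
    then have "\<forall>\<^sub>F n in sequentially. (1/2)^n * e < d"
      using small by (rule order_tendstoD(2)[rotated])
    then show "\<forall>\<^sub>F n in sequentially. \<forall>x\<in>ball ?k r. dist (f n x) (\<phi> x) < d"
    proof eventually_elim
      case (elim n)
      show ?case
      proof
        fix x assume "x \<in> ball ?k r"
        then have "dist (f n x) (\<phi> x) \<le> (1/2)^n * e"
          by (intro conv) (simp add: dist_commute)
        then show "dist (f n x) (\<phi> x) < d" using elim by linarith
      qed
    qed
  qed
  have f_hol: "f n holomorphic_on ball ?k r" for n
  proof (induction n)
    case 0
    then show ?case by (simp add: f_def)
  next
    case (Suc n)
    have "(\<lambda>z. cwindow a z (f n z)) holomorphic_on ball ?k r"
      using f_in reg_near r Suc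
      by (intro cwindow_comp_holomorphic) (auto simp: dist_commute)
    then have "(\<lambda>z. f n z - (cwindow a z (f n z) - of_real c) / A) holomorphic_on ball ?k r"
      using A Suc by (intro holomorphic_intros) auto
    then show ?case by (simp add: f_def T_def)
  qed
  have \<phi>_hol: "\<phi> holomorphic_on ball ?k r"
  proof (rule holomorphic_uniform_sequence[OF open_ball f_hol])
    fix x assume "x \<in> ball ?k r"
    then obtain d where "d > 0" "cball x d \<subseteq> ball ?k r"
      using open_contains_cball[THEN iffD1, OF open_ball] by blast
    then show "\<exists>d>0. cball x d \<subseteq> ball ?k r \<and> uniform_limit (cball x d) f \<phi> sequentially"
      using uniform_limit_on_subset[OF ulim] by blast
  qed
  have \<phi>_eq: "cwindow a k (\<phi> k) = of_real c" if "dist k ?k < r" for k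
    using \<phi>[OF that] A by (simp add: T_def)
  have real: "\<exists>u>0. regular k u \<and> window a k u = c \<and> \<phi> (of_real k) = of_real u"
    if "\<bar>k - k0\<bar> < r" for k
  proof -
    have k: "dist (of_real k) ?k < r"
      using that by (simp add: dist_of_real dist_real_def)
    have f_real: "f n (of_real k) \<in> \<real>" for n
    proof (induction n)
      case 0
      then show ?case by (simp add: f_def)
    next
      case (Suc n)
      then obtain u where u: "f n (of_real k) = of_real u" by (elim Reals_cases)
      have regu: "regular k u"
        using reg_near[of "of_real k" "f n (of_real k)"] f_in[OF k, of n] k r u by (simp add: cregular_of_real)
      have "f (Suc n) (of_real k) = T (of_real k) (of_real u)" using u by (simp add: f_def)
      also have "\<dots> = of_real (u - (window a k u - c) / A')"
        by (simp add: T_def A' cwindow_of_real[OF regu])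
      finally show ?case by simp
    qed
    have "(\<lambda>n. f n (of_real k)) \<longlonglongrightarrow> \<phi> (of_real k)"
      using tendsto_uniform_limitI[OF ulim] k by (simp add: dist_commute)
    then have "\<phi> (of_real k) \<in> \<real>"
      using f_real by (intro Lim_in_closed_set[OF closed_complex_Reals]) auto
    then obtain u where u: "\<phi> (of_real k) = of_real u" by (elim Reals_cases)
    have "regular k u"
      using reg_near[of "of_real k" "of_real u"] \<phi>[OF k] k r u by (simp add: cregular_of_real)
    moreover have "window a k u = c"
      using \<phi>_eq[OF k] u cwindow_of_real[OF \<open>regular k u\<close>, of a] by simp
    moreover have "u > 0"
    proof -
      have "\<bar>u0 - u\<bar> \<le> e" using \<phi>[OF k] u by (simp add: dist_of_real dist_real_def)
      then show ?thesis using e u0 by linarith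
    qed
    ultimately show ?thesis using u by blast
  qed
  show ?thesis using that r(1) \<phi>_hol real by blast
qed

section \<open>The half-width and countability of level sets\<close>

text \<open>The value \<open>u = 0\<close> is left out because the slope in \<open>u\<close>
  vanishes there by evenness and the implicit function breaks down;
  \<open>countable_ambiguous_section\<close> treats it separately.\<close>

definition reach :: "real \<Rightarrow> real \<Rightarrow> real set" where
  "reach a c = {k. \<exists>u>0. regular k u \<and> window a k u = c}"

definition half_width :: "real \<Rightarrow> real \<Rightarrow> real \<Rightarrow> real" where
  "half_width a c k = (THE u. u > 0 \<and> regular k u \<and> window a k u = c)"

lemma window_inj_right:
  assumes "a \<ge> 0" "regular k u" "regular k u'" "u \<ge> 0" "u' \<ge> 0" "window a k u = window a k u'"
  shows "u = u'"
  using assms window_strict_antimono_right[of a k u u'] window_strict_antimono_right[of a k u' u]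
  by (cases u u' rule: linorder_cases) auto

lemma half_width_eq:
  assumes "a \<ge> 0" "u > 0" "regular k u" "window a k u = c"
  shows "half_width a c k = u"
  unfolding half_width_def
proof (rule the_equality)
  fix v assume "v > 0 \<and> regular k v \<and> window a k v = c"
  then show "v = u" using assms by (intro window_inj_right[of a k v u]) auto
qed (use assms in auto)

lemma half_width:
  assumes "a \<ge> 0" "k \<in> reach a c"
  shows "half_width a c k > 0" "regular k (half_width a c k)" "window a k (half_width a c k) = c"
  using assms half_width_eq[OF assms(1)] by (auto simp: reach_def)

text \<open>Intermediate value theorem between \<open>u\<close> and a far point, where the rate is
  below \<open>c\<close>.\<close>

lemma reachI_greater:
  assumes "a \<ge> 0" "c > 0" "regular k u" "u \<ge> 0" "window a k u > c"
  shows "k \<in> reach a c"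
proof -
  obtain v where v: "v > u" "window a k v < c"
    using window_small_beyond[OF assms(1,2)] by blast
  have reg: "regular k w" if "w \<ge> u" for w
    using that assms by (auto simp: regular_def)
  have "continuous_on {u..v} (\<lambda>w. (k, w))"
    by (intro continuous_intros)
  then have "continuous_on {u..v} (\<lambda>w. window a k w)"
    using continuous_on_compose2[OF continuous_on_window, of "{u..v}" "\<lambda>w. (k, w)" a] reg
    by (auto simp: image_subset_iff)
  then obtain w where w: "u \<le> w" "w \<le> v" "window a k w = c"
    using IVT2'[of "window a k" v c u] v assms by auto
  moreover have "w \<noteq> u" using w assms by auto
  ultimately show ?thesis
    using reg[of w] assms(4) by (auto simp: reach_def intro!: exI[of _ w])
qed

text \<open>On the trajectory itself the rate is unbounded just beyond \<open>u = 1/2\<close>, so it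
  exceeds \<open>c\<close> there.\<close>

lemma zero_in_reach:
  assumes "a \<ge> 0" "c > 0"
  shows "0 \<in> reach a c"
proof -
  obtain \<delta> where \<delta>: "\<delta> > 0"
      "\<And>k u. \<bar>k\<bar> \<le> \<delta> \<Longrightarrow> \<bar>u\<bar> \<le> 1/2 + \<delta> \<Longrightarrow> regular k u \<Longrightarrow> window a k u > c"
    using window_large_near_singularity[OF assms(1)] by metis
  then have "window a 0 (1/2 + \<delta>) > c"
    by (intro \<delta>(2)) (auto simp: regular_def)
  then show ?thesis
    using assms \<delta>(1) by (intro reachI_greater[of a c 0 "1/2 + \<delta>"]) (auto simp: regular_def)
qed

text \<open>A smaller offset raises the rate above \<open>c\<close> at the old half-width. The case
  \<open>k' = 0\<close> is separate because that point may be singular.\<close>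

lemma reach_antimono_abs:
  assumes "a \<ge> 0" "c > 0" "k \<in> reach a c" "\<bar>k'\<bar> < \<bar>k\<bar>"
  shows "k' \<in> reach a c"
proof (cases "k' = 0")
  case True
  then show ?thesis using zero_in_reach assms by simp
next
  case False
  let ?u = "half_width a c k"
  have "regular k' ?u" using False by (simp add: regular_def)
  then have "window a k' ?u > c"
    using window_strict_antimono_left[OF assms(1) _ assms(4), of ?u] half_width[OF assms(1,3)] by simp
  then show ?thesis
    using \<open>regular k' ?u\<close> assms half_width[OF assms(1,3)]
    by (intro reachI_greater[of a c k' ?u]) auto
qed

lemma half_width_minus: "half_width a c (- k) = half_width a c k"
  by (simp add: half_width_def window_minus_left regular_def)

lemma half_width_analytic:
  assumes "a \<ge> 0" "k0 \<in> reach a c"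
  obtains r \<phi> where "r > 0" "\<phi> holomorphic_on ball (of_real k0) r"
    "\<And>k. \<bar>k - k0\<bar> < r \<Longrightarrow> k \<in> reach a c \<and> \<phi> (of_real k) = of_real (half_width a c k)"
proof -
  obtain r \<phi> where r: "r > 0" "\<phi> holomorphic_on ball (of_real k0) r"
    "\<And>k. \<bar>k - k0\<bar> < r \<Longrightarrow> \<exists>u>0. regular k u \<and> window a k u = c \<and> \<phi> (of_real k) = of_real u"
    using analytic_implicit_function[OF assms(1) half_width(2,1,3)[OF assms]] by metis
  have "k \<in> reach a c \<and> \<phi> (of_real k) = of_real (half_width a c k)" if "\<bar>k - k0\<bar> < r" for k
    using r(3)[OF that] half_width_eq[OF assms(1)] by (auto simp: reach_def)
  then show ?thesis using that r by blast
qed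

lemma open_reach:
  assumes "a \<ge> 0"
  shows "open (reach a c)"
  unfolding open_dist dist_real_def
  using half_width_analytic[OF assms] by (metis)

text \<open>A set closed under decreasing absolute value is an interval. Connectedness spreads a
  local identity to all offsets.\<close>

lemma connected_reach:
  assumes "a \<ge> 0" "c > 0"
  shows "connected (reach a c)"
proof -
  have "is_interval (reach a c)"
    unfolding is_interval_1
  proof (intro ballI allI impI)
    fix x y z assume *: "x \<in> reach a c" "y \<in> reach a c" "x \<le> z \<and> z \<le> y"
    show "z \<in> reach a c"
    proof (cases "z = x \<or> z = y")
      case False
      then have "\<bar>z\<bar> < \<bar>x\<bar> \<or> \<bar>z\<bar> < \<bar>y\<bar>" using * by auto
      then show ?thesis using * assms reach_antimono_abs by blast
    qed (use * in auto)
  qed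
  then show ?thesis by (simp add: is_interval_connected_1)
qed

section \<open>The identity theorem on the real line as a countability dichotomy\<close>

lemma countable_if_no_limit_point:
  fixes Z :: "'a::euclidean_space set"
  assumes "open I" "Z \<subseteq> I" "\<And>x. x \<in> I \<Longrightarrow> \<not> x islimpt Z"
  shows "countable Z"
proof -
  have "Z sparse_in I"
    unfolding sparse_in_def using assms by blast
  then have "countable (I \<inter> Z)"
    using sparse_imp_countable assms(1) by blast
  then show ?thesis using assms(2) by (simp add: Int_absorb1)
qed

text \<open>The limit points of \<open>Z\<close> in \<open>I\<close> form a relatively closed set,
  and by \<open>loc\<close> an open one; connectedness leaves none or all. Analyticity enters only
  through \<open>loc\<close>, so singular points of the function can be handled there.\<close>

lemma countable_or_everything:
  fixes Z :: "real set"
  assumes I: "open I" "connected I" and Z: "Z \<subseteq> I"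
    and loc: "\<And>x. x \<in> I \<Longrightarrow> x islimpt Z \<Longrightarrow> \<exists>e>0. ball x e \<subseteq> Z"
  shows "countable Z \<or> Z = I"
proof -
  define L where "L = {x \<in> I. x islimpt Z}"
  have "open L"
    unfolding open_subopen[of L]
  proof
    fix x assume "x \<in> L"
    then obtain e where e: "e > 0" "ball x e \<subseteq> Z" using loc by (auto simp: L_def)
    have "y \<in> L" if "y \<in> ball x e" for y
      using e that Z islimpt_subset[of y "ball x e" Z]
      by (auto simp: L_def islimpt_ball)
    then show "\<exists>T. open T \<and> x \<in> T \<and> T \<subseteq> L" using e by (intro exI[of _ "ball x e"]) auto
  qed
  then have "openin (top_of_set I) L"
    by (intro open_openin_trans) (use I in \<open>auto simp: L_def\<close>)
  moreover have "closedin (top_of_set I) L"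
    unfolding closedin_closed L_def
    by (intro exI[of _ "{x. x islimpt Z}"]) (auto simp: closed_limpts)
  ultimately have "L = {} \<or> L = I"
    using I(2) by (auto simp: connected_clopen)
  then show ?thesis
  proof
    assume "L = {}"
    then show ?thesis
      using countable_if_no_limit_point[OF I(1) Z] by (auto simp: L_def)
  next
    assume "L = I"
    then have "I \<subseteq> Z" using loc by (force simp: L_def)
    then show ?thesis using Z by auto
  qed
qed

text \<open>Real zeros accumulating at \<open>x\<close> also accumulate in the complex disc, where
  analytic continuation applies.\<close>

lemma holomorphic_real_zeros:
  assumes "H holomorphic_on ball (of_real x) r" "x islimpt Z"
    and 0: "\<And>k. k \<in> Z \<Longrightarrow> \<bar>k - x\<bar> < r \<Longrightarrow> H (of_real k) = 0"
    and k: "\<bar>k - x\<bar> < r"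
  shows "H (of_real k) = 0"
proof (rule analytic_continuation[OF assms(1), of "of_real ` (Z \<inter> ball x r)" "of_real x"])
  have r: "r > 0" using k by linarith
  show "of_real x \<in> ball (complex_of_real x) r" using r by simp
  show "of_real ` (Z \<inter> ball x r) \<subseteq> ball (complex_of_real x) r"
    by (auto simp: dist_of_real)
  show "complex_of_real x islimpt of_real ` (Z \<inter> ball x r)"
    unfolding islimpt_approachable
  proof (intro allI impI)
    fix e :: real assume "e > 0"
    then obtain y where "y \<in> Z" "y \<noteq> x" "dist y x < min e r"
      using assms(2) r unfolding islimpt_approachable by (metis min_less_iff_conj)
    then show "\<exists>x'\<in>of_real ` (Z \<inter> ball x r). x' \<noteq> complex_of_real x \<and> dist x' (of_real x) < e"
      by (auto simp: dist_of_real dist_commute intro!: bexI[of _ y])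
  qed
  show "H z = 0" if "z \<in> of_real ` (Z \<inter> ball x r)" for z
    using that 0 by (auto simp: dist_real_def abs_minus_commute)
  show "of_real k \<in> ball (complex_of_real x) r"
    using k by (simp add: dist_of_real dist_real_def abs_minus_commute)
qed auto

text \<open>Supplies the local holomorphic extensions for the identity theorem. The radius shrinks
  to keep the complex values of \<open>p\<close> and \<open>q\<close> in the open set of
  \<open>cregular\<close> pairs.\<close>

lemma window_comp_analytic:
  assumes "r > 0" and hol: "p holomorphic_on ball (of_real x) r" "q holomorphic_on ball (of_real x) r"
    and p: "\<And>k. \<bar>k - x\<bar> < r \<Longrightarrow> p (of_real k) = of_real (P k)"
    and q: "\<And>k. \<bar>k - x\<bar> < r \<Longrightarrow> q (of_real k) = of_real (Q k)"
    and reg: "regular (P x) (Q x)"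
  obtains r' H where "0 < r'" "r' \<le> r" "H holomorphic_on ball (of_real x) r'"
    "\<And>k. \<bar>k - x\<bar> < r' \<Longrightarrow> regular (P k) (Q k) \<and> H (of_real k) = of_real (window a (P k) (Q k))"
proof -
  define W where "W = ball (of_real x) r \<inter> (\<lambda>z. (p z, q z)) -` {(k, u). cregular k u}"
  have "open W"
    unfolding W_def using hol
    by (intro continuous_open_preimage open_cregular continuous_intros holomorphic_on_imp_continuous_on) auto
  moreover have "of_real x \<in> W"
    using assms p[of x] q[of x] by (simp add: W_def cregular_of_real)
  ultimately obtain r' where r': "r' > 0" "ball (of_real x) r' \<subseteq> W"
    by (rule openE)
  define r2 where "r2 = min r r'"
  have r2: "r2 > 0" "r2 \<le> r" "ball (of_real x) r2 \<subseteq> W" using r' assms(1) by (auto simp: r2_def)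
  have "(\<lambda>z. cwindow a (p z) (q z)) holomorphic_on ball (of_real x) r2"
    using r2 hol[THEN holomorphic_on_subset, of "ball (of_real x) r2"]
    by (intro cwindow_comp_holomorphic) (auto simp: W_def)
  moreover have "regular (P k) (Q k) \<and> cwindow a (p (of_real k)) (q (of_real k)) = of_real (window a (P k) (Q k))"
    if k: "\<bar>k - x\<bar> < r2" for k
  proof -
    have "of_real k \<in> W"
      using k r2 by (auto simp: dist_of_real dist_real_def abs_minus_commute)
    then have "regular (P k) (Q k)"
      using p[of k] q[of k] k r2 by (auto simp: W_def cregular_of_real)
    then show ?thesis
      using p[of k] q[of k] k r2 cwindow_of_real by auto
  qed
  ultimately show ?thesis using that r2 by blast
qed

text \<open>The count for the third sensor, with shift and competing level fixed. If all of
  \<open>reach\<close> belonged to the set, so would some nonzero \<open>k\<close> and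
  \<open>- k\<close>; they have equal half-widths, but shifted offsets of different absolute value,
  against strict monotonicity.\<close>

lemma countable_level_set:
  assumes a: "a \<ge> 0" and c: "c > 0" and d: "d \<noteq> 0"
  shows "countable {k \<in> reach a c. regular (k + d) (half_width a c k) \<and>
           window a (k + d) (half_width a c k) = c'}"
proof -
  let ?I = "reach a c" and ?h = "half_width a c"
  define Z where "Z = {k \<in> ?I. regular (k + d) (?h k) \<and> window a (k + d) (?h k) = c'}"
  have "countable Z \<or> Z = ?I"
  proof (rule countable_or_everything)
    fix x assume x: "x \<in> ?I" and lim: "x islimpt Z"
    obtain r \<phi> where r: "r > 0" and hol: "\<phi> holomorphic_on ball (of_real x) r"
      and \<phi>: "\<And>k. \<bar>k - x\<bar> < r \<Longrightarrow> k \<in> ?I \<and> \<phi> (of_real k) = of_real (?h k)"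
      using half_width_analytic[OF a x] by metis
    show "\<exists>e>0. ball x e \<subseteq> Z"
    proof (cases "regular (x + d) (?h x)")
      case True
      have "(\<lambda>z. z + of_real d) holomorphic_on ball (of_real x) r"
        by (intro holomorphic_intros)
      then obtain r' H where r': "0 < r'" "r' \<le> r" "H holomorphic_on ball (of_real x) r'"
        and H: "\<And>k. \<bar>k - x\<bar> < r' \<Longrightarrow> regular (k + d) (?h k) \<and>
            H (of_real k) = of_real (window a (k + d) (?h k))"
        using window_comp_analytic[OF r _ hol, of "\<lambda>z. z + of_real d" "\<lambda>k. k + d" ?h a] \<phi> True by auto
      have "H (of_real k) - of_real c' = 0" if "\<bar>k - x\<bar> < r'" for k
      proof (rule holomorphic_real_zeros[where H = "\<lambda>z. H z - of_real c'", OF _ lim])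
        show "(\<lambda>z. H z - of_real c') holomorphic_on ball (of_real x) r'"
          by (intro holomorphic_intros r')
      qed (use that H in \<open>auto simp: Z_def\<close>)
      then have "ball x r' \<subseteq> Z"
        using H \<phi> r' by (auto simp: Z_def dist_real_def abs_minus_commute)
      then show ?thesis using r' by blast
    next
      case False
      \<comment> \<open>At a singular \<open>x\<close>, continuity of the half-width would give
        points of \<open>Z\<close> near \<open>x\<close> a rate above \<open>c'\<close>, so the case
        is contradictory.\<close>
      then have xd: "x + d = 0" "\<bar>?h x\<bar> \<le> 1/2" by (auto simp: regular_def)
      obtain \<delta> where \<delta>: "\<delta> > 0"
          "\<And>k u. \<bar>k\<bar> \<le> \<delta> \<Longrightarrow> \<bar>u\<bar> \<le> 1/2 + \<delta> \<Longrightarrow> regular k u \<Longrightarrow> window a k u > c'"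
        using window_large_near_singularity[OF a] by metis
      have "isCont \<phi> (of_real x)"
        using holomorphic_on_imp_continuous_on[OF hol] r
        by (simp add: continuous_on_eq_continuous_at)
      then obtain s where s: "s > 0" "\<And>z. dist z (of_real x) < s \<Longrightarrow> dist (\<phi> z) (\<phi> (of_real x)) < \<delta>"
        using \<delta>(1) unfolding continuous_at_eps_delta by metis
      define e where "e = min (min r s) \<delta>"
      have e: "e > 0" "e \<le> r" "e \<le> s" "e \<le> \<delta>" using r s \<delta> by (auto simp: e_def)
      obtain k where k: "k \<in> Z" "dist k x < e"
        using lim e(1) unfolding islimpt_approachable by metis
      have "dist (\<phi> (of_real k)) (\<phi> (of_real x)) < \<delta>"
        using k e by (intro s(2)) (simp add: dist_of_real)
      then have "\<bar>?h k - ?h x\<bar> < \<delta>"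
        using \<phi>[of k] \<phi>[of x] k e by (simp add: dist_of_real dist_real_def)
      then have "\<bar>?h k\<bar> \<le> 1/2 + \<delta>" using xd by linarith
      moreover have "\<bar>k + d\<bar> \<le> \<delta>" using k e xd unfolding dist_real_def by linarith
      ultimately have "window a (k + d) (?h k) > c'"
        using k by (intro \<delta>(2)) (auto simp: Z_def)
      then show ?thesis using k by (auto simp: Z_def)
    qed
  qed (use open_reach connected_reach a c in \<open>auto simp: Z_def\<close>)
  moreover have "Z \<noteq> ?I"
  proof
    assume all: "Z = ?I"
    obtain e where e: "e > 0" "ball 0 e \<subseteq> ?I"
      using open_reach[OF a] zero_in_reach[OF a c] by (rule openE)
    define k where "k = e / 2"
    have k: "k > 0" "k \<in> Z" "- k \<in> Z" using e all by (auto simp: k_def)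
    then have 1: "regular (k + d) (?h k)" "regular (- k + d) (?h k)"
      "window a (k + d) (?h k) = c'" "window a (- k + d) (?h k) = c'"
      by (auto simp: Z_def half_width_minus)
    have "\<bar>k + d\<bar> < \<bar>- k + d\<bar> \<or> \<bar>- k + d\<bar> < \<bar>k + d\<bar>" using k d by linarith
    then show False
      using 1 window_strict_antimono_left[OF a 1(1), of "- k + d"]
        window_strict_antimono_left[OF a 1(2), of "k + d"] by auto
  qed
  ultimately show ?thesis by (simp add: Z_def)
qed

text \<open>For regular \<open>d\<close> close to \<open>x\<close> the first rate exceeds every
  bound, while the second stays below its value at offset \<open>(k2 - k1) / 2\<close>; so they
  cannot agree.\<close>

lemma window_singular_not_limit:
  assumes a: "a \<ge> 0" and x: "\<not> regular (k1 + x) u1" and ne: "k1 \<noteq> k2"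
  shows "\<not> x islimpt {d. regular (k1 + d) u1 \<and> regular (k2 + d) u2 \<and>
           window a (k1 + d) u1 = window a (k2 + d) u2}"
proof
  assume lim: "x islimpt {d. regular (k1 + d) u1 \<and> regular (k2 + d) u2 \<and>
           window a (k1 + d) u1 = window a (k2 + d) u2}"
  have x0: "k1 + x = 0" and u1: "\<bar>u1\<bar> \<le> 1/2" using x by (auto simp: regular_def)
  define M where "M = window a \<bar>(k2 - k1) / 2\<bar> u2"
  obtain \<delta> where \<delta>: "\<delta> > 0"
      "\<And>k u. \<bar>k\<bar> \<le> \<delta> \<Longrightarrow> \<bar>u\<bar> \<le> 1/2 + \<delta> \<Longrightarrow> regular k u \<Longrightarrow> window a k u > M"
    using window_large_near_singularity[OF a] by metis
  have "min \<delta> (\<bar>k2 - k1\<bar> / 2) > 0" using \<delta>(1) ne by simp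
  then obtain d where d: "regular (k1 + d) u1" "window a (k1 + d) u1 = window a (k2 + d) u2"
      and near: "dist d x < min \<delta> (\<bar>k2 - k1\<bar> / 2)"
    using lim unfolding islimpt_approachable by blast
  have "window a (k1 + d) u1 > M"
    using near x0 u1 \<delta>(1) d(1) by (intro \<delta>(2)) (auto simp: dist_real_def)
  moreover have "window a (k2 + d) u2 < M"
    unfolding M_def
  proof (rule window_strict_antimono_left[OF a])
    show "regular \<bar>(k2 - k1) / 2\<bar> u2" using ne by (simp add: regular_def)
    have "d - x < \<bar>k2 - k1\<bar> / 2" "x - d < \<bar>k2 - k1\<bar> / 2"
      using near unfolding dist_real_def by linarith+
    then have "\<bar>k2 - k1\<bar> / 2 < \<bar>k2 + d\<bar>"
      using x0 by (cases "k1 \<le> k2") (simp_all add: abs_real_def field_simps)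
    then show "\<bar>\<bar>(k2 - k1) / 2\<bar>\<bar> < \<bar>k2 + d\<bar>"
      by simp
  qed
  ultimately show False using d by simp
qed

text \<open>Each rate peaks strictly where its own shifted offset is \<open>0\<close>, and for
  \<open>k1 \<noteq> k2\<close> these shifts differ; so the rates cannot agree for all
  \<open>d\<close>.\<close>

lemma countable_shifts:
  assumes a: "a \<ge> 0" and ne: "k1 \<noteq> k2"
  shows "countable {d. regular (k1 + d) u1 \<and> regular (k2 + d) u2 \<and>
           window a (k1 + d) u1 = window a (k2 + d) u2}" (is "countable ?Z")
proof -
  have "countable ?Z \<or> ?Z = UNIV"
  proof (rule countable_or_everything)
    fix x assume lim: "x islimpt ?Z"
    have reg: "regular (k1 + x) u1" "regular (k2 + x) u2"
    proof -
      show "regular (k1 + x) u1" using window_singular_not_limit[OF a _ ne] lim by blast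
      have "?Z = {d. regular (k2 + d) u2 \<and> regular (k1 + d) u1 \<and>
           window a (k2 + d) u2 = window a (k1 + d) u1}" by auto
      with lim have "x islimpt {d. regular (k2 + d) u2 \<and> regular (k1 + d) u1 \<and>
           window a (k2 + d) u2 = window a (k1 + d) u1}" by (simp only:)
      then show "regular (k2 + x) u2"
        using window_singular_not_limit[OF a _ ne[symmetric]] by blast
    qed
    have *: "\<exists>r H. r > 0 \<and> H holomorphic_on ball (of_real x) r \<and> (\<forall>d. \<bar>d - x\<bar> < r \<longrightarrow>
        regular (k + d) u \<and> H (of_real d) = of_real (window a (k + d) u))"
      if "regular (k + x) u" for k u
    proof -
      have "(\<lambda>z. of_real k + z) holomorphic_on ball (of_real x) 1"
        "(\<lambda>_. of_real u) holomorphic_on ball (complex_of_real x) 1"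
        by (intro holomorphic_intros)+
      then show ?thesis
      proof (rule window_comp_analytic[OF zero_less_one])
        show "regular (k + x) u" by fact
        fix r' H assume "0 < r'" "H holomorphic_on ball (of_real x) r'"
          "\<And>d. \<bar>d - x\<bar> < r' \<Longrightarrow> regular (k + d) u \<and> H (of_real d) = of_real (window a (k + d) u)"
        then show ?thesis by blast
      qed auto
    qed
    obtain r1 H1 where 1: "r1 > 0" "H1 holomorphic_on ball (of_real x) r1"
        "\<And>d. \<bar>d - x\<bar> < r1 \<Longrightarrow> regular (k1 + d) u1 \<and> H1 (of_real d) = of_real (window a (k1 + d) u1)"
      using *[OF reg(1)] by blast
    obtain r2 H2 where 2: "r2 > 0" "H2 holomorphic_on ball (of_real x) r2"
        "\<And>d. \<bar>d - x\<bar> < r2 \<Longrightarrow> regular (k2 + d) u2 \<and> H2 (of_real d) = of_real (window a (k2 + d) u2)"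
      using *[OF reg(2)] by blast
    define r where "r = min r1 r2"
    have r: "r > 0" "r \<le> r1" "r \<le> r2" using 1 2 by (auto simp: r_def)
    have "H1 (of_real d) - H2 (of_real d) = 0" if "\<bar>d - x\<bar> < r" for d
    proof (rule holomorphic_real_zeros[where H = "\<lambda>z. H1 z - H2 z", OF _ lim])
      show "(\<lambda>z. H1 z - H2 z) holomorphic_on ball (of_real x) r"
        using r by (intro holomorphic_intros holomorphic_on_subset[OF 1(2)] holomorphic_on_subset[OF 2(2)]) auto
    qed (use that 1(3) 2(3) r in auto)
    then have "d \<in> ?Z" if "\<bar>d - x\<bar> < r" for d
      using that 1(3)[of d] 2(3)[of d] r by auto
    then have "ball x r \<subseteq> ?Z" by (auto simp: dist_real_def abs_minus_commute)
    then show "\<exists>e>0. ball x e \<subseteq> ?Z" using r(1) by blast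
  qed auto
  moreover have "?Z \<noteq> UNIV"
  proof
    assume "?Z = UNIV"
    \<comment> \<open>Each of these shifts brings one offset to \<open>0\<close>; the equalities
      then give \<open>window a 0 u1 < window a 0 u2 < window a 0 u1\<close>.\<close>
    then have "- k1 \<in> ?Z" "- k2 \<in> ?Z" by auto
    then have 1: "regular 0 u1" "regular 0 u2" "window a 0 u1 = window a (k2 - k1) u2"
      "window a (k1 - k2) u1 = window a 0 u2" by auto
    have "window a (k2 - k1) u2 < window a 0 u2" "window a (k1 - k2) u1 < window a 0 u1"
      using ne window_strict_antimono_left[OF a 1(2), of "k2 - k1"]
        window_strict_antimono_left[OF a 1(1), of "k1 - k2"] by simp_all
    then show False using 1 by simp
  qed
  ultimately show ?thesis by blast
qed

section \<open>Ambiguous triples of offsets\<close>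

text \<open>An open set is a countable union of compact sets; the level set meets each in a compact
  set, whose projection is compact. Projections of general Borel sets need not be Borel.\<close>

lemma borel_projection_of_level_set:
  fixes g :: "'a::euclidean_space \<times> 'b::euclidean_space \<Rightarrow> 'c::t1_space"
  assumes "open W" "continuous_on W g"
  shows "fst ` {x \<in> W. g x = z} \<in> sets borel"
proof -
  obtain C where C: "\<And>n::nat. compact (C n)" "\<And>n. C n \<subseteq> W" "\<Union>(range C) = W"
    using open_Union_compact_subsets[OF assms(1)] by metis
  have "compact {x \<in> C n. g x = z}" for n
  proof -
    have "closed {x \<in> C n. g x = z}"
      using C continuous_on_subset[OF assms(2)]
      by (intro continuous_closed_preimage_constant) (auto simp: compact_imp_closed)
    then show ?thesis
      using C(1)[of n] by (metis (no_types, lifting) compact_Int_closed inf_absorb2 mem_Collect_eq subsetI)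
  qed
  then have "compact (fst ` {x \<in> C n. g x = z})" for n
    by (intro compact_continuous_image continuous_intros)
  then have "(\<Union>n. fst ` {x \<in> C n. g x = z}) \<in> sets borel"
    by (intro sets.countable_UN borel_compact image_subsetI)
  also have "(\<Union>n. fst ` {x \<in> C n. g x = z}) = fst ` {x \<in> W. g x = z}"
    using C(3) by auto
  finally show ?thesis .
qed

text \<open>The competitor has the same \<open>a\<close>, as its speed agrees, and offsets shifted
  by a common \<open>d\<close>. Its unknown level is eliminated by comparing the shifted rates with
  one another. No sign is imposed on the \<open>u\<close>s, so that all side conditions are
  open.\<close>

definition ambiguous :: "real \<Rightarrow> real \<Rightarrow> (real \<times> real \<times> real) set" where
  "ambiguous a c = {(k1, k2, k3). \<exists>u1 u2 u3 d. d \<noteq> 0 \<and>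
     (regular k1 u1 \<and> window a k1 u1 = c) \<and>
     (regular k2 u2 \<and> window a k2 u2 = c) \<and>
     (regular k3 u3 \<and> window a k3 u3 = c) \<and>
     regular (k1 + d) u1 \<and>
     (regular (k2 + d) u2 \<and> window a (k1 + d) u1 = window a (k2 + d) u2) \<and>
     (regular (k3 + d) u3 \<and> window a (k1 + d) u1 = window a (k3 + d) u3)}"

lemma continuous_on_window_comp [continuous_intros]:
  assumes "continuous_on S f" "continuous_on S g" "\<And>x. x \<in> S \<Longrightarrow> regular (f x) (g x)"
  shows "continuous_on S (\<lambda>x. window a (f x) (g x))"
  using continuous_on_compose2[OF continuous_on_window continuous_on_Pair[OF assms(1,2)], of a] assms(3)
  by (auto simp: image_subset_iff)

lemma open_Collect_regular:
  assumes "continuous_on UNIV f" "continuous_on UNIV g"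
  shows "open {x. regular (f x) (g x)}"
  using open_vimage[OF open_regular continuous_on_Pair[OF assms]] by (simp add: vimage_def)

text \<open>The variables are grouped so that \<open>fst\<close> keeps the offsets and discards
  half-widths and shift. The side conditions form the open set \<open>W\<close>, the equations a
  level set of \<open>g\<close>.\<close>

lemma ambiguous_borel: "ambiguous a c \<in> sets borel"
proof -
  let ?k1 = "\<lambda>x::(real \<times> real \<times> real) \<times> ((real \<times> real \<times> real) \<times> real). fst (fst x)"
  let ?k2 = "\<lambda>x::(real \<times> real \<times> real) \<times> ((real \<times> real \<times> real) \<times> real). fst (snd (fst x))"
  let ?k3 = "\<lambda>x::(real \<times> real \<times> real) \<times> ((real \<times> real \<times> real) \<times> real). snd (snd (fst x))"
  let ?u1 = "\<lambda>x::(real \<times> real \<times> real) \<times> ((real \<times> real \<times> real) \<times> real). fst (fst (snd x))"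
  let ?u2 = "\<lambda>x::(real \<times> real \<times> real) \<times> ((real \<times> real \<times> real) \<times> real). fst (snd (fst (snd x)))"
  let ?u3 = "\<lambda>x::(real \<times> real \<times> real) \<times> ((real \<times> real \<times> real) \<times> real). snd (snd (fst (snd x)))"
  let ?d = "\<lambda>x::(real \<times> real \<times> real) \<times> ((real \<times> real \<times> real) \<times> real). snd (snd x)"
  define W where "W = {x. ?d x \<noteq> 0} \<inter> {x. regular (?k1 x) (?u1 x)} \<inter> {x. regular (?k2 x) (?u2 x)}
    \<inter> {x. regular (?k3 x) (?u3 x)} \<inter> {x. regular (?k1 x + ?d x) (?u1 x)}
    \<inter> {x. regular (?k2 x + ?d x) (?u2 x)} \<inter> {x. regular (?k3 x + ?d x) (?u3 x)}"
  define g where "g = (\<lambda>x. (window a (?k1 x) (?u1 x), window a (?k2 x) (?u2 x), window a (?k3 x) (?u3 x),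
    window a (?k1 x + ?d x) (?u1 x) - window a (?k2 x + ?d x) (?u2 x),
    window a (?k1 x + ?d x) (?u1 x) - window a (?k3 x + ?d x) (?u3 x)))"
  have "open W"
    unfolding W_def by (intro open_Int open_Collect_regular open_Collect_neq continuous_intros)
  moreover have "continuous_on W g"
    unfolding g_def by (intro continuous_intros) (auto simp: W_def)
  ultimately have "fst ` {x \<in> W. g x = (c, c, c, 0, 0)} \<in> sets borel"
    by (rule borel_projection_of_level_set)
  also have "fst ` {x \<in> W. g x = (c, c, c, 0, 0)} = ambiguous a c"
    by (force simp: W_def g_def ambiguous_def image_iff)
  finally show ?thesis .
qed

section \<open>Countable sections of the ambiguous set\<close>

lemma countable_if_abs_eq:
  assumes "\<And>x y. x \<in> A \<Longrightarrow> y \<in> A \<Longrightarrow> \<bar>x\<bar> = \<bar>y\<bar>"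
  shows "countable (A :: real set)"
proof (cases "A = {}")
  case False
  then obtain x where "x \<in> A" by blast
  then have "A \<subseteq> {x, - x}" using assms by (fastforce simp: abs_eq_iff)
  then show ?thesis by (rule countable_subset) auto
qed auto

lemma window_abs_right: "window a k \<bar>u\<bar> = window a k u"
  by (simp add: abs_if window_minus_right)

lemma regular_abs_right: "regular k \<bar>u\<bar> \<longleftrightarrow> regular k u"
  by (simp add: regular_def)

lemma countable_window_eq_right:
  assumes "a \<ge> 0"
  shows "countable {u. regular k u \<and> window a k u = c}"
proof (rule countable_if_abs_eq)
  fix u v assume *: "u \<in> {u. regular k u \<and> window a k u = c}" "v \<in> {u. regular k u \<and> window a k u = c}"
  show "\<bar>u\<bar> = \<bar>v\<bar>"
    by (rule window_inj_right[OF assms, of k]) (use * in \<open>simp_all add: window_abs_right regular_abs_right\<close>)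
qed

lemma countable_window_eq_left:
  assumes "a \<ge> 0"
  shows "countable {k. regular k u \<and> window a k u = c}"
proof (rule countable_if_abs_eq)
  fix k l assume *: "k \<in> {k. regular k u \<and> window a k u = c}" "l \<in> {k. regular k u \<and> window a k u = c}"
  show "\<bar>k\<bar> = \<bar>l\<bar>"
    using * window_strict_antimono_left[OF assms, of k u l] window_strict_antimono_left[OF assms, of l u k]
    by (cases "\<bar>k\<bar>" "\<bar>l\<bar>" rule: linorder_cases) auto
qed

text \<open>Each choice is countable in turn: \<open>k1\<close> and \<open>k2\<close> fix
  \<open>u1\<close> and \<open>u2\<close> up to sign, \<open>countable_shifts\<close> limits
  \<open>d\<close>, these determine the competing level, and \<open>countable_level_set\<close>
  limits \<open>k3\<close>.\<close>

lemma countable_ambiguous_section: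
  assumes a: "a \<ge> 0" and c: "c > 0" and ne: "k1 \<noteq> k2"
  shows "countable {k3. (k1, k2, k3) \<in> ambiguous a c}"
proof -
  let ?U = "\<lambda>k. {u. regular k u \<and> window a k u = c}"
  let ?D = "\<lambda>u1 u2. {d. regular (k1 + d) u1 \<and> regular (k2 + d) u2 \<and>
           window a (k1 + d) u1 = window a (k2 + d) u2} - {0}"
  let ?K = "\<lambda>d c'. {k \<in> reach a c. regular (k + d) (half_width a c k) \<and>
           window a (k + d) (half_width a c k) = c'}"
  \<comment> \<open>The first set collects the third offsets with half-width \<open>0\<close>, which
    \<open>reach\<close> excludes.\<close>
  let ?B = "{k. regular k 0 \<and> window a k 0 = c} \<union>
    (\<Union>u1\<in>?U k1. \<Union>u2\<in>?U k2. \<Union>d\<in>?D u1 u2. ?K d (window a (k1 + d) u1))"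
  have "{k3. (k1, k2, k3) \<in> ambiguous a c} \<subseteq> ?B"
  proof
    fix k3 assume "k3 \<in> {k3. (k1, k2, k3) \<in> ambiguous a c}"
    then obtain u1 u2 u3 d where d: "d \<noteq> 0" and
     1: "regular k1 u1" "window a k1 u1 = c" and
     2: "regular k2 u2" "window a k2 u2 = c" and
     3: "regular k3 u3" "window a k3 u3 = c" and
     r: "regular (k1 + d) u1" "regular (k2 + d) u2" "regular (k3 + d) u3" and
     w: "window a (k1 + d) u1 = window a (k2 + d) u2" "window a (k1 + d) u1 = window a (k3 + d) u3"
      unfolding ambiguous_def by blast
    show "k3 \<in> ?B"
    proof (cases "u3 = 0")
      case True
      then show ?thesis using 3 by blast
    next
      case False
      note abs = window_abs_right regular_abs_right
      have h: "half_width a c k3 = \<bar>u3\<bar>"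
        by (rule half_width_eq[OF a]) (use False 3 abs in auto)
      have "k3 \<in> reach a c"
        unfolding reach_def using False 3 abs by (auto intro!: exI[of _ "\<bar>u3\<bar>"])
      then have "k3 \<in> ?K d (window a (k1 + d) u1)"
        using h r(3) w(2) abs by simp
      moreover have "d \<in> ?D u1 u2" using d r w by simp
      ultimately show ?thesis using 1 2 by blast
    qed
  qed
  moreover have "countable ?B"
    by (intro countable_Un countable_UN countable_Diff countable_window_eq_left countable_window_eq_right
        countable_shifts countable_level_set a c ne) auto
  ultimately show ?thesis by (rule countable_subset)
qed

text \<open>Were the singular integrand integrable, its integral would dominate the rates at small
  offsets, which exceed every bound. As thresholds are positive, time stamps are therefore
  regular.\<close>

lemma window_not_regular:
  assumes a: "a \<ge> 0" and nreg: "\<not> regular k u"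
  shows "window a k u = 0"
proof -
  define f where "f = (\<lambda>t. decay a (k\<^sup>2 + (u - 1/2 + t)\<^sup>2))"
  have k: "k = 0" and u: "\<bar>u\<bar> \<le> 1/2" using nreg by (auto simp: regular_def)
  have "\<not> f integrable_on {0..1}"
  proof
    assume int: "f integrable_on {0..1}"
    obtain \<delta> where \<delta>: "\<delta> > 0"
      "\<And>k u. \<bar>k\<bar> \<le> \<delta> \<Longrightarrow> \<bar>u\<bar> \<le> 1/2 + \<delta> \<Longrightarrow> regular k u \<Longrightarrow> window a k u > integral {0..1} f"
      using window_large_near_singularity[OF a] by metis
    have reg: "regular \<delta> u" using \<delta>(1) by (simp add: regular_def)
    \<comment> \<open>At the singular point itself \<open>f\<close> has the junk value \<open>0\<close>, which \<open>g\<close> replaces.\<close>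
    define g where "g = (\<lambda>t. if t = 1/2 - u then decay a (\<delta>\<^sup>2) else f t)"
    have g: "(g has_integral integral {0..1} f) {0..1}"
      by (rule has_integral_spike[OF negligible_sing[of "1/2 - u"] _ integrable_integral[OF int]])
        (auto simp: g_def)
    have "window a \<delta> u \<le> integral {0..1} g"
      unfolding window_def
    proof (rule integral_le)
      show "(\<lambda>t. decay a (\<delta>\<^sup>2 + (u - 1/2 + t)\<^sup>2)) integrable_on {0..1}"
        by (rule integrable_continuous_real[OF continuous_on_window_integrand[OF reg]])
      show "g integrable_on {0..1}" using g by (rule has_integral_integrable)
      fix t :: real
      show "decay a (\<delta>\<^sup>2 + (u - 1/2 + t)\<^sup>2) \<le> g t"
      proof (cases "t = 1/2 - u")
        case False
        then have "0 < (u - 1/2 + t)\<^sup>2" by simp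
        then have "decay a (\<delta>\<^sup>2 + (u - 1/2 + t)\<^sup>2) < decay a ((u - 1/2 + t)\<^sup>2)"
          using \<delta>(1) by (intro decay_strict_antimono a) auto
        then show ?thesis using False by (simp add: g_def f_def k)
      qed (simp add: g_def)
    qed
    moreover have "window a \<delta> u > integral {0..1} f"
      using \<delta>(1) u reg by (intro \<delta>(2)) auto
    ultimately show False using integral_unique[OF g] by simp
  qed
  then show ?thesis by (simp add: window_def f_def not_integrable_integral)
qed

section \<open>Time stamps in coordinates along the trajectory\<close>

text \<open>The angle is measured from the \<open>y\<close> axis:
  \<open>(sin theta, cos theta)\<close> is the unit direction of motion and
  \<open>(cos theta, - sin theta)\<close> the normal used in \<open>offset\<close>.\<close>

definition along :: "real \<Rightarrow> real \<Rightarrow> real \<Rightarrow> real \<times> real \<Rightarrow> real" where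
  "along xo yo theta p = (fst p - xo) * sin theta + (snd p - yo) * cos theta"

text \<open>Keeping the sign lets a parallel displacement of the trajectory shift all offsets by one
  constant.\<close>

definition offset :: "real \<Rightarrow> real \<Rightarrow> real \<Rightarrow> real \<times> real \<Rightarrow> real" where
  "offset xo yo theta p = (fst p - xo) * cos theta - (snd p - yo) * sin theta"

lemma src_dist_eq:
  assumes "s > 0"
  shows "src_dist t0 xo yo theta s p t =
    s * sqrt ((offset xo yo theta p / s)\<^sup>2 + (t - (t0 + along xo yo theta p / s))\<^sup>2)"
proof -
  define A B C where "A = fst p - xo" and "B = snd p - yo" and "C = s * (t - t0)"
  define S K where "S = sin theta" and "K = cos theta"
  have SK: "S\<^sup>2 + K\<^sup>2 = 1" by (simp add: S_def K_def)
  have "(C * S - A)\<^sup>2 + (C * K - B)\<^sup>2 = C\<^sup>2 * (S\<^sup>2 + K\<^sup>2) - 2 * C * (A * S + B * K) + A\<^sup>2 + B\<^sup>2"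
    by (simp add: power2_eq_square algebra_simps)
  also have "\<dots> = C\<^sup>2 - 2 * C * (A * S + B * K) + (A\<^sup>2 + B\<^sup>2) * (S\<^sup>2 + K\<^sup>2)"
    by (simp add: SK)
  also have "\<dots> = (A * K - B * S)\<^sup>2 + (C - (A * S + B * K))\<^sup>2"
    by (simp add: power2_eq_square algebra_simps)
  also have "\<dots> = s\<^sup>2 * (((A * K - B * S) / s)\<^sup>2 + (t - (t0 + (A * S + B * K) / s))\<^sup>2)"
    using assms by (simp add: C_def power2_eq_square field_simps)
  finally have sq: "(C * S - A)\<^sup>2 + (C * K - B)\<^sup>2 =
      s\<^sup>2 * ((offset xo yo theta p / s)\<^sup>2 + (t - (t0 + along xo yo theta p / s))\<^sup>2)"
    by (simp only: along_def offset_def A_def B_def S_def K_def)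
  have "src_dist t0 xo yo theta s p t = sqrt ((C * S - A)\<^sup>2 + (C * K - B)\<^sup>2)"
    by (simp add: src_dist_def traj_x_def traj_y_def A_def B_def C_def S_def K_def algebra_simps)
  then show ?thesis
    unfolding sq using assms by (simp add: real_sqrt_mult)
qed

text \<open>Measuring lengths in units of \<open>s\<close> turns the shielding into
  \<open>alpha * s\<close> and leaves the factor \<open>1 / s\<^sup>2\<close> of the inverse square
  law, which later moves into the threshold.\<close>

lemma window_int_eq:
  assumes "s > 0"
  shows "window_int alpha t0 xo yo theta s p t =
    window (alpha * s) (offset xo yo theta p / s) (t - (t0 + along xo yo theta p / s)) / s\<^sup>2"
proof -
  let ?k = "offset xo yo theta p / s" and ?tp = "t0 + along xo yo theta p / s"
  have "exp (- alpha * src_dist t0 xo yo theta s p tau) / (src_dist t0 xo yo theta s p tau)\<^sup>2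
      = decay (alpha * s) (?k\<^sup>2 + (tau - ?tp)\<^sup>2) / s\<^sup>2" for tau
    unfolding src_dist_eq[OF assms] decay_def
    by (simp add: power_mult_distrib mult.assoc mult.commute)
  then have "window_int alpha t0 xo yo theta s p t =
      integral {t - 1/2..t + 1/2} (\<lambda>tau. decay (alpha * s) (?k\<^sup>2 + (tau - ?tp)\<^sup>2)) / s\<^sup>2"
    by (simp add: window_int_def)
  also have "integral {t - 1/2..t + 1/2} (\<lambda>tau. decay (alpha * s) (?k\<^sup>2 + (tau - ?tp)\<^sup>2)) =
      window (alpha * s) ?k (t - ?tp)"
    using integral_shift_real_ivl[of "t - ?tp - 1/2" "- ?tp" "t - ?tp + 1/2"
        "\<lambda>tau. decay (alpha * s) (?k\<^sup>2 + tau\<^sup>2)"]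
    by (simp add: window_shift algebra_simps)
  finally show ?thesis .
qed

text \<open>The triggering set is symmetric about the time of closest approach, so that time is the
  midpoint of its extremes. At the last stamp the threshold is met with equality, since a strict
  excess would persist for a while by continuity.\<close>

lemma time_stamps_window:
  assumes "alpha \<ge> 0" "s > 0" "lam_s > 0" "lam_T > lam_b"
    and st: "time_stamps alpha lam_b lam_T t0 xo yo theta s lam_s p t1 t2"
  shows "t1 + t2 = 2 * (t0 + along xo yo theta p / s)"
    and "regular (offset xo yo theta p / s) ((t2 - t1) / 2)"
    and "window (alpha * s) (offset xo yo theta p / s) ((t2 - t1) / 2) = (lam_T - lam_b) / lam_s * s\<^sup>2"
proof -
  define k tp a where "k = offset xo yo theta p / s" and "tp = t0 + along xo yo theta p / s"
    and "a = alpha * s"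
  define c where "c = (lam_T - lam_b) / lam_s * s\<^sup>2"
  have a: "a \<ge> 0" and c: "c > 0" using assms by (auto simp: a_def c_def)
  define T where "T = {t. window a k (t - tp) \<ge> c}"
  have "trig_set alpha lam_b lam_T t0 xo yo theta s lam_s p = T"
    using assms(2) by (auto simp: trig_set_def T_def window_int_eq c_def k_def tp_def a_def pos_le_divide_eq)
  then have t: "t1 \<in> T" "t2 \<in> T" "\<And>t. t \<in> T \<Longrightarrow> t1 \<le> t" "\<And>t. t \<in> T \<Longrightarrow> t \<le> t2"
    using st by (auto simp: time_stamps_def)
  have refl: "2 * tp - t \<in> T" if "t \<in> T" for t
    using that window_minus_right[of a k "t - tp"] by (simp add: T_def)
  show sum: "t1 + t2 = 2 * tp"
    using t(3)[OF refl[OF t(2)]] t(4)[OF refl[OF t(1)]] by linarith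
  then have U: "(t2 - t1) / 2 = t2 - tp" by (simp add: field_simps)
  have ge: "window a k (t2 - tp) \<ge> c" using t(2) by (simp add: T_def)
  \<comment> \<open>A singular window has the default integral \<open>0\<close>, below the positive
    threshold.\<close>
  then have reg: "regular k (t2 - tp)"
    using window_not_regular[OF a] c by force
  then show "regular k ((t2 - t1) / 2)" by (simp add: U)
  have "\<not> window a k (t2 - tp) > c"
  proof
    assume gt: "window a k (t2 - tp) > c"
    have "isCont (\<lambda>(k, u). window a k u) (k, t2 - tp)"
      using continuous_on_window[of a] open_regular reg by (simp add: continuous_on_eq_continuous_at)
    moreover have "isCont (\<lambda>t. (k, t - tp)) t2" by (intro continuous_intros)
    ultimately have "isCont (\<lambda>t. window a k (t - tp)) t2"
      using isCont_o2[where f = "\<lambda>t. (k, t - tp)" and g = "\<lambda>(k, u). window a k u" and a = t2] by simp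
    then have "\<forall>\<^sub>F t in at t2. window a k (t - tp) > c"
      using gt unfolding isCont_def by (rule order_tendstoD(1))
    then obtain e where e: "e > 0" "\<And>t. t \<noteq> t2 \<Longrightarrow> dist t t2 < e \<Longrightarrow> window a k (t - tp) > c"
      unfolding eventually_at by blast
    have "t2 + e / 2 \<in> T"
      using e(2)[of "t2 + e / 2"] e(1) by (simp add: T_def dist_real_def)
    then show False using t(4) e(1) by fastforce
  qed
  then show "window a k ((t2 - t1) / 2) = c" using ge by (simp add: U)
qed

section \<open>Almost sure uniqueness\<close>

lemma AE_off_line:
  assumes "prob_space P" "sets P = sets borel" "absolutely_continuous lborel P"
    and "\<alpha> \<noteq> 0 \<or> \<beta> \<noteq> (0::real)"
  shows "AE p in P. \<alpha> * fst p + \<beta> * snd p \<noteq> \<gamma>"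
proof -
  let ?N = "{p::real \<times> real. \<alpha> * fst p + \<beta> * snd p = \<gamma>}"
  have "?N = {p. (\<alpha>, \<beta>) \<bullet> p = \<gamma>}" by (auto simp: inner_prod_def)
  then have "negligible ?N"
    using assms(4) by (simp add: negligible_hyperplane zero_prod_def)
  moreover have "closed ?N" by (intro closed_Collect_eq continuous_intros)
  ultimately have "?N \<in> null_sets lborel"
    by (simp add: negligible_iff_null_sets null_sets_completion_iff borel_closed)
  then have "?N \<in> null_sets P"
    using assms(3) by (auto simp: absolutely_continuous_def)
  then show ?thesis by (auto dest: AE_not_in)
qed

text \<open>Fubini twice, with the first point arbitrary. Null sections give a null set only under
  measurability, hence the Borel assumption.\<close>

lemma AE_triple:
  assumes "prob_space P" and sets: "sets P = sets (borel :: (real \<times> real) measure)"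
    and Q: "{\<omega>. Q \<omega>} \<in> sets borel"
    and AE: "\<And>p1. AE p2 in P. AE p3 in P. Q (p1, p2, p3)"
  shows "AE \<omega> in P \<Otimes>\<^sub>M (P \<Otimes>\<^sub>M P). Q \<omega>"
proof -
  interpret P: prob_space P by fact
  interpret PP: pair_prob_space P P ..
  interpret PPP: pair_prob_space P "P \<Otimes>\<^sub>M P" ..
  have sp: "space P = UNIV" using sets_eq_imp_space_eq[OF sets] by simp
  have sPP: "sets (P \<Otimes>\<^sub>M P) = sets borel"
    using sets_pair_measure_cong[OF sets sets] unfolding borel_prod .
  have sPPP: "sets (P \<Otimes>\<^sub>M (P \<Otimes>\<^sub>M P)) = sets borel"
    using sets_pair_measure_cong[OF sets sPP] unfolding borel_prod .
  have sec: "{y. Q (p1, y)} \<in> sets borel" for p1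
    using measurable_sets_borel[of "\<lambda>y. (p1, y)" borel "{\<omega>. Q \<omega>}"] Q
    by (simp add: vimage_def borel_measurable_continuous_onI continuous_intros)
  have "AE x in P. AE y in P \<Otimes>\<^sub>M P. Q (x, y)"
  proof (rule AE_I2)
    fix p1
    have "AE (p2, p3) in P \<Otimes>\<^sub>M P. Q (p1, p2, p3)"
    proof (rule PP.AE_pair_measure)
      show "{x \<in> space (P \<Otimes>\<^sub>M P). case x of (p2, p3) \<Rightarrow> Q (p1, p2, p3)} \<in> sets (P \<Otimes>\<^sub>M P)"
        using sec[of p1] by (simp add: space_pair_measure sp sPP case_prod_unfold)
      show "AE x in P. AE y in P. case (x, y) of (p2, p3) \<Rightarrow> Q (p1, p2, p3)"
        using AE by simp
    qed
    then show "AE y in P \<Otimes>\<^sub>M P. Q (p1, y)" by (simp add: case_prod_unfold)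
  qed
  then show ?thesis
    using Q by (intro PPP.AE_pair_measure) (simp_all add: space_pair_measure sp sPPP)
qed

text \<open>For any first sensor, the second avoids the parallel to the trajectory through it; the
  third avoids the line through both and countably many further parallels. Lines are null.\<close>

lemma AE_unambiguous:
  assumes P: "prob_space P" "sets P = sets borel" "absolutely_continuous lborel P"
    and a: "a \<ge> 0" and c: "c > 0" and s: "s > 0"
  shows "AE \<omega> in P \<Otimes>\<^sub>M (P \<Otimes>\<^sub>M P).
    (case \<omega> of (p1, p2, p3) \<Rightarrow>
      (fst p2 - fst p1) * (snd p3 - snd p1) \<noteq> (snd p2 - snd p1) * (fst p3 - fst p1) \<and>
      (offset xo yo theta p1 / s, offset xo yo theta p2 / s, offset xo yo theta p3 / s) \<notin> ambiguous a c)"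
proof (rule AE_triple[OF P(1,2)])
  define K where "K = (\<lambda>p. offset xo yo theta p / s)"
  have K_cont: "continuous_on S (\<lambda>x. K (f x))" if "continuous_on S f" for S :: "'z::topological_space set" and f
    unfolding K_def offset_def using that s by (intro continuous_intros) auto
  let ?k = "\<lambda>\<omega>. (K (fst \<omega>), K (fst (snd \<omega>)), K (snd (snd \<omega>)))"
  have "?k -` ambiguous a c \<in> sets borel"
    by (intro measurable_sets_borel[OF borel_measurable_continuous_onI] ambiguous_borel
        continuous_on_Pair K_cont continuous_intros)
  then have "- (?k -` ambiguous a c) \<in> sets borel" by (rule borel_comp)
  moreover have "open {\<omega>::(real\<times>real)\<times>(real\<times>real)\<times>(real\<times>real).
      (fst (fst (snd \<omega>)) - fst (fst \<omega>)) * (snd (snd (snd \<omega>)) - snd (fst \<omega>)) \<noteq>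
      (snd (fst (snd \<omega>)) - snd (fst \<omega>)) * (fst (snd (snd \<omega>)) - fst (fst \<omega>))}" (is "open ?det")
    by (intro open_Collect_neq continuous_intros)
  ultimately have "?det \<inter> - (?k -` ambiguous a c) \<in> sets borel" by auto
  also have "?det \<inter> - (?k -` ambiguous a c) = {\<omega>. case \<omega> of (p1, p2, p3) \<Rightarrow>
      (fst p2 - fst p1) * (snd p3 - snd p1) \<noteq> (snd p2 - snd p1) * (fst p3 - fst p1) \<and>
      (offset xo yo theta p1 / s, offset xo yo theta p2 / s, offset xo yo theta p3 / s) \<notin> ambiguous a c}"
    by (auto simp: K_def)
  finally show "{\<omega>. case \<omega> of (p1, p2, p3) \<Rightarrow>
      (fst p2 - fst p1) * (snd p3 - snd p1) \<noteq> (snd p2 - snd p1) * (fst p3 - fst p1) \<and>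
      (offset xo yo theta p1 / s, offset xo yo theta p2 / s, offset xo yo theta p3 / s) \<notin> ambiguous a c}
      \<in> sets borel" .
  fix p1
  have nz: "cos theta \<noteq> 0 \<or> - sin theta \<noteq> 0"
    using sin_zero_norm_cos_one[of theta] by auto
  have K_level: "K p = k \<longleftrightarrow> cos theta * fst p + (- sin theta) * snd p =
      k * s + cos theta * xo - sin theta * yo" for p k
    using s by (auto simp: K_def offset_def field_simps)
  have AE_K: "AE p in P. K p \<noteq> k" for k
    unfolding K_level by (rule AE_off_line[OF P nz])
  have "AE p2 in P. AE p3 in P.
      (fst p2 - fst p1) * (snd p3 - snd p1) \<noteq> (snd p2 - snd p1) * (fst p3 - fst p1) \<and>
      (K p1, K p2, K p3) \<notin> ambiguous a c"
    using AE_K[of "K p1"]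
  proof eventually_elim
    case (elim p2)
    let ?x = "fst p2 - fst p1" and ?y = "snd p2 - snd p1"
    have "p2 \<noteq> p1" using elim by auto
    then have "- ?y \<noteq> 0 \<or> ?x \<noteq> 0" by (auto simp: prod_eq_iff)
    from AE_off_line[OF P this, of "?x * snd p1 - ?y * fst p1"]
    have 1: "AE p3 in P. ?x * (snd p3 - snd p1) \<noteq> ?y * (fst p3 - fst p1)"
      by eventually_elim (simp add: algebra_simps)
    have "countable {k3. (K p1, K p2, k3) \<in> ambiguous a c}"
      using elim by (intro countable_ambiguous_section a c) auto
    then have "AE p3 in P. \<forall>k\<in>{k3. (K p1, K p2, k3) \<in> ambiguous a c}. K p3 \<noteq> k"
      using AE_K by (subst AE_ball_countable) auto
    with 1 show ?case by eventually_elim auto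
  qed
  then show "AE p2 in P. AE p3 in P. case (p1, p2, p3) of (p1, p2, p3) \<Rightarrow>
      (fst p2 - fst p1) * (snd p3 - snd p1) \<noteq> (snd p2 - snd p1) * (fst p3 - fst p1) \<and>
      (offset xo yo theta p1 / s, offset xo yo theta p2 / s, offset xo yo theta p3 / s) \<notin> ambiguous a c"
    by (simp add: K_def)
qed

text \<open>The vector \<open>(sin theta, cos theta) / s\<close> has norm \<open>1 / s\<close>,
  which gives the speed; the angle is then fixed modulo \<open>2 * pi\<close>, and its half-open
  range does the rest.\<close>

lemma direction_unique:
  assumes th: "0 \<le> theta" "theta < 2 * pi" "0 \<le> theta'" "theta' < 2 * pi"
    and s: "s > 0" "s' > (0::real)"
    and eq: "sin theta / s = sin theta' / s'" "cos theta / s = cos theta' / s'"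
  shows "theta' = theta \<and> s' = s"
proof -
  have "(sin theta / s)\<^sup>2 + (cos theta / s)\<^sup>2 = 1 / s\<^sup>2"
    using sin_cos_squared_add[of theta] by (simp add: power_divide flip: add_divide_distrib)
  moreover have "(sin theta' / s')\<^sup>2 + (cos theta' / s')\<^sup>2 = 1 / s'\<^sup>2"
    using sin_cos_squared_add[of theta'] by (simp add: power_divide flip: add_divide_distrib)
  ultimately have "s\<^sup>2 = s'\<^sup>2" using eq s by simp
  then have ss: "s' = s" using s by (simp add: power2_eq_iff_nonneg)
  then have "sin theta' = sin theta" "cos theta' = cos theta" using eq s by auto
  then obtain n :: int where n: "theta' = theta + 2 * pi * of_int n"
    using sin_cos_eq_iff by (metis)
  have "n = 0"
  proof (rule ccontr)
    assume "n \<noteq> 0"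
    then have "n \<ge> 1 \<or> n \<le> - 1" by linarith
    then show False
    proof
      assume "n \<ge> 1"
      then have "2 * pi * of_int n \<ge> 2 * pi * 1" by (intro mult_left_mono) auto
      then show False using n th by linarith
    next
      assume "n \<le> - 1"
      then have "of_int n \<le> (- 1 :: real)" by linarith
      then have "2 * pi * of_int n \<le> 2 * pi * (- 1)" by (intro mult_left_mono) auto
      then show False using n th by linarith
    qed
  qed
  then show ?thesis using n ss by simp
qed

theorem theorem1:
  fixes alpha lam_b lam_T t0 :: real
    and P :: "(real \<times> real) measure"
    and xo yo theta s lam_s :: real
  assumes "alpha \<ge> 0" and "lam_T > lam_b"
    and "prob_space P" and "sets P = sets borel" and "absolutely_continuous lborel P"
    and "0 \<le> theta" and "theta < 2 * pi" and "s > 0" and "lam_s > 0"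
  shows "AE \<omega> in P \<Otimes>\<^sub>M (P \<Otimes>\<^sub>M P).
           (\<forall>p \<in> {fst \<omega>, fst (snd \<omega>), snd (snd \<omega>)}.
              \<exists>t1 t2. time_stamps alpha lam_b lam_T t0 xo yo theta s lam_s p t1 t2) \<longrightarrow>
           (\<forall>xo' yo' theta' s' lam_s'.
              0 \<le> theta' \<and> theta' < 2 * pi \<and> s' > 0 \<and> lam_s' > 0 \<and>
              (\<forall>p \<in> {fst \<omega>, fst (snd \<omega>), snd (snd \<omega>)}. \<forall>t1 t2.
                 time_stamps alpha lam_b lam_T t0 xo yo theta s lam_s p t1 t2 \<longrightarrow>
                 time_stamps alpha lam_b lam_T t0 xo' yo' theta' s' lam_s' p t1 t2) \<longrightarrow>
              theta' = theta \<and> s' = s \<and> xo' = xo \<and> yo' = yo)"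
proof -
  define a c where "a = alpha * s" and "c = (lam_T - lam_b) / lam_s * s\<^sup>2"
  have a: "a \<ge> 0" and c: "c > 0" using assms by (auto simp: a_def c_def)
  note stamps = time_stamps_window[OF assms(1) _ _ assms(2)]
  from AE_unambiguous[OF assms(3,4,5) a c assms(8), of xo yo theta]
  show ?thesis
  proof eventually_elim
    case (elim \<omega>)
    obtain p1 p2 p3 where \<omega>: "\<omega> = (p1, p2, p3)" by (cases \<omega>) auto
    have noncol: "(fst p2 - fst p1) * (snd p3 - snd p1) \<noteq> (snd p2 - snd p1) * (fst p3 - fst p1)"
      and unamb: "(offset xo yo theta p1 / s, offset xo yo theta p2 / s, offset xo yo theta p3 / s) \<notin> ambiguous a c"
      using elim \<omega> by auto
    show ?case
    proof (intro impI allI)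
      fix xo' yo' theta' s' lam_s'
      assume ex: "\<forall>p \<in> {fst \<omega>, fst (snd \<omega>), snd (snd \<omega>)}.
              \<exists>t1 t2. time_stamps alpha lam_b lam_T t0 xo yo theta s lam_s p t1 t2"
        and asm: "0 \<le> theta' \<and> theta' < 2 * pi \<and> s' > 0 \<and> lam_s' > 0 \<and>
              (\<forall>p \<in> {fst \<omega>, fst (snd \<omega>), snd (snd \<omega>)}. \<forall>t1 t2.
                 time_stamps alpha lam_b lam_T t0 xo yo theta s lam_s p t1 t2 \<longrightarrow>
                 time_stamps alpha lam_b lam_T t0 xo' yo' theta' s' lam_s' p t1 t2)"
      then have th': "0 \<le> theta'" "theta' < 2 * pi" "s' > 0" "lam_s' > 0" by auto
      define c' where "c' = (lam_T - lam_b) / lam_s' * s'\<^sup>2"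
      \<comment> \<open>Equal midpoints of the stamps give the first part, after cancelling
        \<open>t0\<close>; the common half-width gives the second.\<close>
      have data: "along xo yo theta p / s = along xo' yo' theta' p / s' \<and>
          (\<exists>u. regular (offset xo yo theta p / s) u \<and> window a (offset xo yo theta p / s) u = c \<and>
            regular (offset xo' yo' theta' p / s') u \<and>
            window (alpha * s') (offset xo' yo' theta' p / s') u = c')"
        if p: "p \<in> {p1, p2, p3}" for p
      proof -
        obtain t1 t2 where t: "time_stamps alpha lam_b lam_T t0 xo yo theta s lam_s p t1 t2"
          using ex p \<omega> by auto
        then have t': "time_stamps alpha lam_b lam_T t0 xo' yo' theta' s' lam_s' p t1 t2"
          using asm p \<omega> by auto
        show ?thesis
          using stamps[OF assms(8,9) t] stamps[OF th'(3,4) t'] unfolding a_def c_def c'_def by auto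
      qed
      \<comment> \<open>\<open>(X, Y)\<close> is the difference of the slowness vectors. Equal times
        of closest approach put the three sensors on one line with this normal, unless it
        vanishes.\<close>
      define X Y where "X = sin theta / s - sin theta' / s'" and "Y = cos theta / s - cos theta' / s'"
      define Z where "Z = xo * sin theta / s + yo * cos theta / s - xo' * sin theta' / s' - yo' * cos theta' / s'"
      have lin: "fst p * X + snd p * Y = Z" if "p \<in> {p1, p2, p3}" for p
        using conjunct1[OF data[OF that]]
        by (simp add: along_def X_def Y_def Z_def add_divide_distrib diff_divide_distrib algebra_simps)
      have 2: "(fst p2 - fst p1) * X + (snd p2 - snd p1) * Y = 0"
        and 3: "(fst p3 - fst p1) * X + (snd p3 - snd p1) * Y = 0"
        using lin[of p1] lin[of p2] lin[of p3] by (simp_all add: algebra_simps)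
      let ?D = "(fst p2 - fst p1) * (snd p3 - snd p1) - (snd p2 - snd p1) * (fst p3 - fst p1)"
      have "X * ?D = 0" "Y * ?D = 0" using 2 3 by algebra+
      then have XY: "X = 0" "Y = 0" using noncol by auto
      have eq: "theta' = theta \<and> s' = s"
        by (rule direction_unique) (use assms th' XY in \<open>auto simp: X_def Y_def\<close>)
      \<comment> \<open>The component of the displacement normal to the motion, in units of
        \<open>s\<close>.\<close>
      define d where "d = ((xo - xo') * cos theta - (yo - yo') * sin theta) / s"
      have off: "offset xo' yo' theta' p / s' = offset xo yo theta p / s + d" for p
        using eq assms(8) by (simp add: offset_def d_def field_simps)
      have win: "\<exists>u. regular (offset xo yo theta p / s) u \<and> window a (offset xo yo theta p / s) u = c \<and>
            regular (offset xo yo theta p / s + d) u \<and> window a (offset xo yo theta p / s + d) u = c'"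
        if "p \<in> {p1, p2, p3}" for p
        using conjunct2[OF data[OF that]] eq unfolding off by (simp add: a_def)
      have "d = 0"
      proof (rule ccontr)
        assume "d \<noteq> 0"
        then have "(offset xo yo theta p1 / s, offset xo yo theta p2 / s, offset xo yo theta p3 / s) \<in> ambiguous a c"
          using win[of p1] win[of p2] win[of p3] unfolding ambiguous_def by fastforce
        then show False using unamb by simp
      qed
      then have n: "(xo - xo') * cos theta - (yo - yo') * sin theta = 0"
        using assms(8) by (simp add: d_def)
      have "Z = ((xo - xo') * sin theta + (yo - yo') * cos theta) / s"
        using eq by (simp add: Z_def add_divide_distrib diff_divide_distrib left_diff_distrib)
      moreover have "Z = 0" using lin[of p1] XY by simp
      ultimately have v: "(xo - xo') * sin theta + (yo - yo') * cos theta = 0"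
        using assms(8) by simp
      \<comment> \<open>\<open>n\<close> and \<open>v\<close> are the coordinates of the
        displacement in an orthonormal frame.\<close>
      have "xo - xo' = 0" "yo - yo' = 0"
        using n v sin_cos_squared_add[of theta] by algebra+
      then show "theta' = theta \<and> s' = s \<and> xo' = xo \<and> yo' = yo"
        using eq by simp
    qed
  qed
qed

end
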